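(* As $n \to \infty$, \[ f(n,5,5) \le n^{1/3}\, 2^{O\left(\sqrt{\log n}\,\log\log n\right)}. \]
   Context: For positive integers $p,q$ with $1 \le q \le \binom{p}{2}$, a $(p,q)$-coloring of the complete graph $K_n$ is an edge-coloring of $K_n$ in which every copy of $K_p$ (every set of $p$ vertices) spans edges of at least $q$ distinct colors. $f(n,p,q)$ denotes the minimum number of colors in a $(p,q)$-coloring of $K_n$. *)

theory Defs
  imports Complex_Main "HOL-Library.Ramsey" "HOL-Library.Landau_Symbols"
begin

text \<open>The vertex set of $K_n$ is \<open>{..<n}\<close> and its edges are the 2-element
  subsets \<open>[{..<n}]\<^bsup>2\<^esup>\<close>.  Only the values of \<open>c\<close> on these edges matter.\<close>

definition pq_coloring :: "nat \<Rightarrow> nat \<Rightarrow> nat \<Rightarrow> (nat set \<Rightarrow> nat) \<Rightarrow> bool" where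
  "pq_coloring n p q c \<longleftrightarrow> (\<forall>S \<in> [{..<n}]\<^bsup>p\<^esup>. q \<le> card (c ` [S]\<^bsup>2\<^esup>))"

definition num_colors :: "nat \<Rightarrow> (nat set \<Rightarrow> nat) \<Rightarrow> nat" where
  "num_colors n c = card (c ` [{..<n}]\<^bsup>2\<^esup>)"

definition gen_ramsey :: "nat \<Rightarrow> nat \<Rightarrow> nat \<Rightarrow> nat" where
  "gen_ramsey n p q = (LEAST k. \<exists>c. pq_coloring n p q c \<and> num_colors n c = k)"

text \<open>In the range \<open>q \<le> p choose 2\<close> the minimum is over a nonempty set.\<close>

lemma pq_coloring_exists:
  assumes "q \<le> p choose 2"
  shows "\<exists>c. pq_coloring n p q c"
proof -
  have "finite ([{..<n}]\<^bsup>2\<^esup>)"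
    by (simp add: finite_imp_finite_nsets)
  from finite_imp_inj_to_nat_seg[OF this] obtain c :: "nat set \<Rightarrow> nat"
    where c: "inj_on c ([{..<n}]\<^bsup>2\<^esup>)"
    by auto
  have "q \<le> card (c ` [S]\<^bsup>2\<^esup>)" if S: "S \<in> [{..<n}]\<^bsup>p\<^esup>" for S
  proof -
    have "[S]\<^bsup>2\<^esup> \<subseteq> [{..<n}]\<^bsup>2\<^esup>"
      using S by (auto simp: nsets_def)
    then have "card (c ` [S]\<^bsup>2\<^esup>) = card ([S]\<^bsup>2\<^esup>)"
      by (intro card_image inj_on_subset[OF c])
    moreover have "[S]\<^bsup>2\<^esup> = {B. B \<subseteq> S \<and> card B = 2}"
      using S by (auto simp: nsets_def intro: finite_subset)
    moreover have "card {B. B \<subseteq> S \<and> card B = 2} = p choose 2"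
      using S by (simp add: nsets_def n_subsets)
    ultimately show ?thesis using assms by simp
  qed
  then have "pq_coloring n p q c"
    by (simp add: pq_coloring_def)
  then show ?thesis by (rule exI[of _ c])
qed

lemma gen_ramsey_attained:
  assumes "q \<le> p choose 2"
  shows "\<exists>c. pq_coloring n p q c \<and> num_colors n c = gen_ramsey n p q"
proof -
  obtain c where "pq_coloring n p q c"
    using pq_coloring_exists[OF assms] by (rule exE)
  then have "\<exists>k c. pq_coloring n p q c \<and> num_colors n c = k"
    by (intro exI[of _ "num_colors n c"] exI[of _ c] conjI refl)
  then show ?thesis
    unfolding gen_ramsey_def by (rule LeastI_ex)
qed

end

theory Submission
  imports Defs "HOL-Algebra.Algebraic_Closure_Type" "HOL-Real_Asymp.Real_Asymp"
begin

text \<open>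
  The colouring is the product of two.  The first one, in the spirit of Mubayi and of Conlon, Fox,
  Lee and Sudakov, writes the vertices in base \<open>M\<close> with about \<open>sqrt (log n)\<close> digits and costs
  \<open>2^O(sqrt (log n))\<close> colours.  It forces a 5-set with at most 4 colours to be built from nested
  complete bipartite monochromatic graphs, in one of three ways: a 4-star over a 3-star over a
  cherry, a 4-star over a \<open>K(2,2)\<close>, or a \<open>K(2,3)\<close> over a cherry in the part of size 3.

  The second one places the vertices in \<open>F\<^sup>3\<close>, where \<open>F\<close> is a field of order \<open>3^k\<close>, \<open>k\<close> odd, and
  uses the symmetric form \<open>B u w = u\<^sub>1 w\<^sub>1 + u\<^sub>2 w\<^sub>2 + u\<^sub>3 + w\<^sub>3\<close>.  A monochromatic star at \<open>v\<close> confines the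
  leaves to a plane whose direction is orthogonal to \<open>v\<close>, so the first and the third structure
  would put three vertices on a line and make the last cherry \<open>u; x, y\<close> satisfy \<open>B u x = B u u\<close>.
  Such degenerate pairs get separate colours that record a difference of coordinates: those stars lie on lines or
  parabolas on which the first coordinate is constant.  In the second structure the two sides of the
  \<open>K(2,2)\<close> are seen from \<open>v\<close>, in the first two coordinates, in perpendicular directions.  As \<open>-1\<close> is
  not a square in \<open>F\<close>, the map \<open>s \<mapsto> -1/s\<close> on slopes has no fixed point, so one more bit \<open>T\<close> of
  colour distinguishes perpendicular directions.
\<close>

subsection \<open>Fields of order \<open>3^k\<close>\<close>

lemma three_eq_0_finite_3_closure: "(3 :: Enum.finite_3 alg_closure) = 0"
proof -
  have "(3 :: Enum.finite_3) = 2 + 1"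
    by (simp only: numeral.simps)
  also have "\<dots> = 0"
    by (simp add: two_finite_3 plus_finite_3_def one_finite_3_def zero_finite_3_def)
  finally have "to_ac (3 :: Enum.finite_3) = to_ac 0"
    by (rule arg_cong)
  then show ?thesis
    by (simp only: to_ac_numeral to_ac_0)
qed

text \<open>For \<open>k > 0\<close>, in an algebraically closed field of characteristic 3, this is
  the subfield of order \<open>3 ^ k\<close>. It is a set rather than a type because
  \<open>k\<close> has to grow with the number of vertices.\<close>

definition frob_fixed :: "nat \<Rightarrow> 'a::comm_ring_1 set"
  where "frob_fixed k = {x. x ^ 3 ^ k = x}"

lemma power3_add:
  assumes "(3 :: 'a::comm_ring_1) = 0"
  shows "(x + y :: 'a) ^ 3 ^ k = x ^ 3 ^ k + y ^ 3 ^ k"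
proof (induction k)
  case (Suc k)
  have cube: "(a + b) ^ 3 = a ^ 3 + b ^ 3" for a b :: 'a
  proof -
    have "(a + b) ^ 3 = a ^ 3 + b ^ 3 + 3 * (a ^ 2 * b + a * b ^ 2)"
      by (simp add: power2_eq_square power3_eq_cube algebra_simps)
    then show ?thesis by (simp add: assms)
  qed
  have "(x + y) ^ 3 ^ Suc k = ((x + y) ^ 3 ^ k) ^ 3"
    by (simp add: power_mult mult.commute flip: power_mult)
  also have "\<dots> = (x ^ 3 ^ k) ^ 3 + (y ^ 3 ^ k) ^ 3"
    by (simp only: Suc cube)
  finally show ?case
    by (simp add: mult.commute flip: power_mult)
qed simp

lemma frob_fixed_uminus: "x \<in> frob_fixed k \<Longrightarrow> - x \<in> frob_fixed k"
  by (simp add: frob_fixed_def)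

lemma frob_fixed_mult: "x \<in> frob_fixed k \<Longrightarrow> y \<in> frob_fixed k \<Longrightarrow> x * y \<in> frob_fixed k"
  by (simp add: frob_fixed_def power_mult_distrib)

lemma frob_fixed_divide:
  "x \<in> frob_fixed k \<Longrightarrow> y \<in> frob_fixed k \<Longrightarrow> x / y \<in> frob_fixed k" for x :: "'a::field"
  by (simp add: frob_fixed_def power_divide)

lemma frob_fixed_add:
  assumes "(3 :: 'a::comm_ring_1) = 0" "(x :: 'a) \<in> frob_fixed k" "y \<in> frob_fixed k"
  shows "x + y \<in> frob_fixed k"
  using assms by (simp add: frob_fixed_def power3_add)

lemma frob_fixed_diff:
  assumes "(3 :: 'a::comm_ring_1) = 0" "(x :: 'a) \<in> frob_fixed k" "y \<in> frob_fixed k"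
  shows "x - y \<in> frob_fixed k"
  using frob_fixed_add[OF assms(1,2) frob_fixed_uminus[OF assms(3)]] by simp

text \<open>If \<open>x ^ 2 = -1\<close>, cubing negates \<open>x\<close>, so for odd
  \<open>k\<close> the power \<open>3 ^ k\<close> sends \<open>x\<close> to \<open>-x\<close>. A
  fixed \<open>x\<close> then has \<open>x + x = 0\<close>, hence \<open>x = 0\<close> in
  characteristic 3.\<close>

lemma minus_one_nonsquare_frob_fixed:
  assumes "(3 :: 'a::field) = 0" "odd k" "(x :: 'a) \<in> frob_fixed k"
  shows "x ^ 2 \<noteq> -1"
proof
  assume sq: "x ^ 2 = -1"
  have cube: "x ^ 3 = - x"
    using sq by (simp add: power3_eq_cube power2_eq_square)
  have "x ^ 3 ^ j = (- 1) ^ j * x" for j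
  proof (induction j)
    case (Suc j)
    have "x ^ 3 ^ Suc j = (x ^ 3 ^ j) ^ 3"
      by (simp add: mult.commute flip: power_mult)
    also have "\<dots> = ((- 1) ^ j) ^ 3 * x ^ 3"
      by (simp add: Suc power_mult_distrib)
    also have "((- 1 :: 'a) ^ j) ^ 3 = (- 1) ^ j"
      by (cases "even j") auto
    finally show ?case by (simp add: cube)
  qed simp
  from this[of k] have "- x = x"
    using assms(2,3) by (simp add: frob_fixed_def)
  then have "x + x = 0" by (metis add.right_inverse)
  moreover have "x = 3 * x - (x + x)" by simp
  ultimately have "x = 0" using assms(1) by (metis diff_zero mult_zero_left)
  then show False using sq by simp
qed

text \<open>The polynomial \<open>X^q - X\<close> is separable, its derivative being \<open>-1\<close>.\<close>

lemma card_frob_fixed: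
  assumes 3: "(3 :: 'a::alg_closed_field) = 0" and "k > 0"
  shows "card (frob_fixed k :: 'a set) = 3 ^ k"
proof -
  define q :: nat where "q = 3 ^ k"
  define p :: "'a poly" where "p = monom 1 q - [:0, 1:]"
  have q: "q > 1"
    using \<open>k > 0\<close> one_less_power[of "3::nat" k] by (simp add: q_def)
  have lt: "degree [:0, 1 :: 'a:] < degree (monom (1::'a) q)"
    using q by (simp add: degree_monom_eq)
  have deg: "degree p = q"
    unfolding p_def diff_conv_add_uminus
    using lt by (subst degree_add_eq_left) (simp_all add: degree_monom_eq)
  then have "p \<noteq> 0" using q by auto
  have roots: "{x. poly p x = 0} = frob_fixed k"
    by (auto simp: p_def frob_fixed_def poly_monom q_def)
  have q0: "(of_nat q :: 'a) = 0"
    using \<open>k > 0\<close> 3 by (simp add: q_def)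
  have pd: "pderiv p = [:-1:]"
    by (simp add: p_def pderiv_diff pderiv_monom q0 pderiv_pCons)
  obtain A where A: "size A = degree p" "p = smult (lead_coeff p) (\<Prod>x\<in>#A. [:-x, 1:])"
    using alg_closed_imp_factorization[OF \<open>p \<noteq> 0\<close>] by blast
  \<comment> \<open>A repeated root of \<open>p\<close> would be a root of \<open>pderiv p\<close>;
    so the multiset \<open>A\<close> of roots is a set and its size counts the distinct
    roots.\<close>
  have "count A a \<le> 1" for a
  proof (rule ccontr)
    assume "\<not> count A a \<le> 1"
    define A' where "A' = A - {#a, a#}"
    have A': "A = add_mset a (add_mset a A')"
      by (rule multiset_eqI) (use \<open>\<not> count A a \<le> 1\<close> in \<open>auto simp: A'_def\<close>)
    define r where "r = smult (lead_coeff p) (\<Prod>x\<in>#A'. [:-x, 1:])"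
    have "p = [:-a, 1:] * ([:-a, 1:] * r)"
      using A(2) by (simp add: A' r_def)
    then have "pderiv p = [:-a, 1:] * pderiv ([:-a, 1:] * r) + [:-a, 1:] * r * pderiv [:-a, 1:]"
      using pderiv_mult[of "[:-a, 1:]" "[:-a, 1:] * r"] by simp
    then have "poly (pderiv p) a = 0" by simp
    then show False by (simp add: pd)
  qed
  then have "count A a = (if a \<in> set_mset A then 1 else 0)" for a
    using count_greater_eq_one_iff[of A a] by (auto intro: antisym simp: not_in_iff)
  then have "A = mset_set (set_mset A)"
    by (intro multiset_eqI) (simp add: count_mset_set')
  then have "size A = card (set_mset A)"
    by (metis size_mset_set)
  moreover have "set_mset A = {x. poly p x = 0}"
  proof -
    have "poly p x = lead_coeff p * (\<Prod>y\<in>#A. x - y)" for x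
      by (subst A(2)) (simp add: poly_prod_mset image_mset.compositionality comp_def)
    then show ?thesis
      using \<open>p \<noteq> 0\<close> by auto
  qed
  ultimately show ?thesis
    using A(1) by (simp add: roots deg q_def)
qed

subsection \<open>Colouring points of a 3-space by a symmetric form\<close>

text \<open>\<open>T_orthogonal\<close> concerns directions that are perpendicular in the first two
  coordinates and not parallel to the axes: their slopes are \<open>s\<close> and
  \<open>-1/s\<close>, and \<open>T\<close> must separate them.\<close>

locale space_coloring =
  fixes X1 X2 X3 :: "'v \<Rightarrow> 'a::field" and T :: "'a \<Rightarrow> bool" and V :: "'v set"
  assumes inj: "\<lbrakk>v \<in> V; w \<in> V; X1 v = X1 w; X2 v = X2 w; X3 v = X3 w\<rbrakk> \<Longrightarrow> v = w"
    and T_orthogonal: "\<lbrakk>v \<in> V; a \<in> V; b \<in> V; X1 a \<noteq> X1 v; X2 a \<noteq> X2 v; X1 b \<noteq> X1 v;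
      (X1 a - X1 v) * (X1 b - X1 v) + (X2 a - X2 v) * (X2 b - X2 v) = 0\<rbrakk>
      \<Longrightarrow> T ((X2 a - X2 v) / (X1 a - X1 v)) \<noteq> T ((X2 b - X2 v) / (X1 b - X1 v))"
begin

text \<open>The third coordinates cancel in a mixed second difference:
  \<open>(B v x - B v y) - (B w x - B w y)\<close> is the ordinary dot product of
  \<open>v - w\<close> and \<open>x - y\<close> in the first two coordinates. Most computations
  below are instances of this identity.\<close>

definition B :: "'v \<Rightarrow> 'v \<Rightarrow> 'a"
  where "B v w = X1 v * X1 w + X2 v * X2 w + X3 v + X3 w"

text \<open>Points with the same first two coordinates are told apart by the third, so they form no
  cherry. For degenerate pairs the recorded difference fixes a coordinate of the leaves of a
  star.\<close>

definition val :: "'v \<Rightarrow> 'v \<Rightarrow> 'a"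
  where "val v w = (if X1 v = X1 w \<and> X2 v = X2 w then X3 v + X3 w
    else if B v w = B v v \<or> B v w = B w w then if X1 v \<noteq> X1 w then X1 w - X1 v else X2 w - X2 v
    else B v w)"

text \<open>For \<open>X1 v = X1 w\<close> the slope is \<open>x / 0 = 0\<close>; \<open>T\<close> is only used when both coordinates differ.\<close>

definition D :: "'v \<Rightarrow> 'v \<Rightarrow> bool \<times> bool \<times> bool \<times> bool \<times> bool \<times> 'a"
  where "D v w = (X1 v = X1 w, X2 v = X2 w, B v w = B v v, B v w = B w w,
    T ((X2 w - X2 v) / (X1 w - X1 v)), val v w)"

lemma B_commute: "B v w = B w v"
  by (simp add: B_def algebra_simps)

lemma slope_commute: "(X2 v - X2 w) / (X1 v - X1 w) = (X2 w - X2 v) / (X1 w - X1 v)"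
  by (metis minus_diff_eq divide_minus_left divide_minus_right minus_minus)

lemma D_swap:
  assumes "D v w = D v' w'"
  shows "D w v = D w' v'"
proof -
  have "X1 w - X1 v = X1 w' - X1 v' \<Longrightarrow> X1 v - X1 w = X1 v' - X1 w'"
    "X2 w - X2 v = X2 w' - X2 v' \<Longrightarrow> X2 v - X2 w = X2 v' - X2 w'"
    by (metis minus_diff_eq)+
  with assms show ?thesis
    unfolding D_def val_def B_commute[of w v] B_commute[of w' v'] slope_commute[of w v] slope_commute[of w' v']
    by (auto simp: eq_commute[of "X1 w"] eq_commute[of "X1 w'"] eq_commute[of "X2 w"] eq_commute[of "X2 w'"]
      add.commute[of "X3 w"] add.commute[of "X3 w'"] split: if_splits)
qed

text \<open>The nondegenerate pairs, on which \<open>val\<close> is \<open>B\<close> itself.\<close>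

definition dot :: "'v \<Rightarrow> 'v \<Rightarrow> bool"
  where "dot v w \<longleftrightarrow> (X1 v = X1 w \<longrightarrow> X2 v \<noteq> X2 w) \<and> B v w \<noteq> B v v \<and> B v w \<noteq> B w w"

text \<open>In the degenerate cases \<open>val\<close> fixes one coordinate of the leaves. If
  \<open>X1 v = X1 w\<close>, the leaves would share \<open>X1\<close> and \<open>X2\<close>, and
  the equation for \<open>B\<close> would fix \<open>X3\<close>. So a degenerate cherry has its
  leaves in a plane of constant \<open>X1\<close> that misses the centre, on a line
  (\<open>out\<close>) or a parabola (\<open>in\<close>).\<close>

lemma cherry_cases:
  assumes "v \<in> V" "w \<in> V" "u \<in> V" "w \<noteq> u" and D: "D v w = D v u"
  obtains (dot) "dot v w" "dot v u" "B v w = B v u"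
  | (out) "X1 v \<noteq> X1 w" "X1 w = X1 u" "B v w = B v v" "B v u = B v v"
  | ("in") "X1 v \<noteq> X1 w" "X1 w = X1 u" "B v w = B w w" "B v u = B u u"
proof -
  have neq: "\<not> (X1 w = X1 u \<and> X2 w = X2 u \<and> X3 w = X3 u)"
    using inj assms by blast
  have bits: "X1 v = X1 w \<longleftrightarrow> X1 v = X1 u" "X2 v = X2 w \<longleftrightarrow> X2 v = X2 u"
    "B v w = B v v \<longleftrightarrow> B v u = B v v" "B v w = B w w \<longleftrightarrow> B v u = B u u" "val v w = val v u"
    using D by (auto simp: D_def)
  show ?thesis
  proof (cases "X1 v = X1 w \<and> X2 v = X2 w")
    case True
    then show ?thesis using bits neq by (auto simp: val_def)
  next
    case F: False
    show ?thesis
    proof (cases "B v w = B v v \<or> B v w = B w w")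
      case False
      then have "B v w = B v u" using F bits by (auto simp: val_def)
      then show ?thesis using dot F bits False by (auto simp: dot_def)
    next
      case True
      show ?thesis
      proof (cases "X1 v = X1 w")
        case False
        then have "X1 w = X1 u" using True F bits by (auto simp: val_def)
        then show ?thesis using True False bits out "in" by auto
      next
        case X1: True
        then have X2: "X2 w = X2 u" using True F bits by (auto simp: val_def)
        have Xu: "X1 u = X1 v" "X1 w = X1 v" using X1 bits by auto
        have "X3 w = X3 u"
          using True
        proof
          assume a: "B v w = B v v"
          then have "B v w = B v u" using bits by simp
          then show ?thesis using Xu X2 by (simp add: B_def)
        next
          assume a: "B v w = B w w"
          then have "B v u = B u u" using bits by simp
          with a show ?thesis using Xu X2 by (simp add: B_def)
        qed
        then show ?thesis using neq Xu X2 by auto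
      qed
    qed
  qed
qed

text \<open>As \<open>u\<close> and \<open>x\<close> differ in \<open>X2\<close>, both
  \<open>v\<close> and \<open>w\<close> can see them at equal values only if
  \<open>X2 v = X2 w\<close>. On the plane of constant \<open>X1\<close> the functions
  \<open>B v\<close> and \<open>B w\<close> then differ by a constant, so \<open>w\<close> sees
  itself at the value of \<open>u\<close>.\<close>

lemma fibre_dot:
  assumes "u \<in> V" "x \<in> V" "u \<noteq> x" "X1 w = X1 u" "X1 w = X1 x"
    and "B v w = B v u" "B v u = B v x" "B w u = B w x"
  shows "B w u = B w w"
proof -
  have "X2 u \<noteq> X2 x"
  proof
    assume "X2 u = X2 x"
    moreover from this have "X3 u = X3 x" using assms by (simp add: B_def)
    ultimately show False using inj assms by auto
  qed
  moreover have "(X2 v - X2 w) * (X2 u - X2 x) = (B v u - B v x) - (B w u - B w x)"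
    using assms(4,5) by (simp add: B_def algebra_simps)
  ultimately have "X2 v = X2 w" using assms(7,8) by simp
  moreover have "B w u - B w w = (B v u - B v w) - (X2 v - X2 w) * (X2 u - X2 w)"
    using assms(4) by (simp add: B_def algebra_simps)
  ultimately show ?thesis using assms(6) by simp
qed

text \<open>The three points lie on a parabola in a plane of constant \<open>X1\<close>; equal
  values at \<open>w\<close> put them on a line, which meets the parabola at most twice.\<close>

lemma parabola_line:
  assumes "u \<in> V" "x \<in> V" "y \<in> V" "X1 u = X1 x" "X1 u = X1 y"
    and "B v u = B u u" "B v x = B x x" "B v y = B y y"
    and "B w u = B w x" "B w u = B w y"
  shows "u = x \<or> u = y \<or> x = y"
proof -
  \<comment> \<open>As for the roots of a quadratic, two distinct points of the intersection have
    \<open>X2\<close>-coordinates with the fixed sum \<open>X2 v + X2 w\<close>.\<close>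
  have "(X2 u - X2 x) * (X2 v + X2 w - X2 u - X2 x)
      = (B v u - B u u) - (B v x - B x x) + (B w u - B w x)"
    using assms(4) by (simp add: B_def algebra_simps)
  then have 1: "(X2 u - X2 x) * (X2 v + X2 w - X2 u - X2 x) = 0"
    using assms by simp
  have "(X2 u - X2 y) * (X2 v + X2 w - X2 u - X2 y)
      = (B v u - B u u) - (B v y - B y y) + (B w u - B w y)"
    using assms(5) by (simp add: B_def algebra_simps)
  then have 2: "(X2 u - X2 y) * (X2 v + X2 w - X2 u - X2 y) = 0"
    using assms by simp
  have "X2 u = X2 x \<or> X2 u = X2 y \<or> X2 x = X2 y"
    using 1 2 by auto
  moreover have "X2 u = X2 x \<Longrightarrow> X3 u = X3 x" "X2 u = X2 y \<Longrightarrow> X3 u = X3 y" "X2 x = X2 y \<Longrightarrow> X3 x = X3 y"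
    using assms(4,5,9,10) by (simp_all add: B_def)
  ultimately show ?thesis using inj assms by metis
qed

text \<open>The planes given by \<open>v\<close> and \<open>w\<close> have different normals and
  meet in a line through \<open>u\<close>, \<open>x\<close>, \<open>y\<close>. If \<open>B u\<close>
  or \<open>X1\<close> agrees at \<open>x\<close> and \<open>y\<close>, it is constant on that line
  and has the same value at \<open>u\<close>.\<close>

lemma line:
  assumes "x \<in> V" "y \<in> V" "x \<noteq> y" "X1 v = X1 w \<longrightarrow> X2 v \<noteq> X2 w"
    and "B v u = B v x" "B v u = B v y" "B w u = B w x" "B w u = B w y"
  shows "B u x = B u y \<Longrightarrow> B u x = B u u" "X1 x = X1 y \<Longrightarrow> X1 u = X1 x"
proof -
  define p q where "p = X1 v - X1 w" and "q = X2 v - X2 w"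
  define d1 d2 where "d1 = X1 x - X1 y" and "d2 = X2 x - X2 y"
  define e1 e2 where "e1 = X1 u - X1 x" and "e2 = X2 u - X2 x"
  define r s where "r = X1 u - X1 v" and "s = X2 u - X2 v"
  note defs = p_def q_def d1_def d2_def e1_def e2_def r_def s_def
  have "p * d1 + q * d2 = (B v x - B v y) - (B w x - B w y)"
    by (simp add: defs B_def algebra_simps)
  then have d: "p * d1 + q * d2 = 0" using assms(5-) by simp
  have "p * e1 + q * e2 = (B v u - B v x) - (B w u - B w x)"
    by (simp add: defs B_def algebra_simps)
  then have e: "p * e1 + q * e2 = 0" using assms(5-) by simp
  have pq: "p \<noteq> 0 \<or> q \<noteq> 0" using assms(4) by (auto simp: defs)
  have ne: "d1 \<noteq> 0 \<or> d2 \<noteq> 0"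
  proof (rule ccontr)
    assume "\<not> ?thesis"
    then have "X1 x = X1 y" "X2 x = X2 y" by (auto simp: defs)
    moreover from this have "X3 x = X3 y" using assms(5,6) by (simp add: B_def)
    ultimately show False using inj assms by auto
  qed
  show "X1 u = X1 x" if "X1 x = X1 y"
  proof -
    have "d1 = 0" using that by (simp add: defs)
    then have "q = 0" using d ne by simp
    then have "e1 = 0" using e pq by simp
    then show ?thesis by (simp add: defs)
  qed
  show "B u x = B u u" if "B u x = B u y"
  proof -
    \<comment> \<open>The projections of \<open>x - y\<close> and \<open>u - x\<close> are both
      orthogonal to the nonzero \<open>(p, q)\<close>, hence parallel.\<close>
    have "p * (d1 * e2 - d2 * e1) = e2 * (p * d1 + q * d2) - d2 * (p * e1 + q * e2)"
      "q * (d1 * e2 - d2 * e1) = d1 * (p * e1 + q * e2) - e1 * (p * d1 + q * d2)"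
      by (simp_all add: algebra_simps)
    then have par: "d1 * e2 - d2 * e1 = 0"
      using pq by (auto simp only: d e mult_zero_right diff_zero mult_eq_0_iff)
    have "r * d1 + s * d2 = (B u x - B u y) - (B v x - B v y)"
      by (simp add: defs B_def algebra_simps)
    then have 1: "r * d1 + s * d2 = 0" using that assms(5,6) by simp
    have "d1 * (r * e1 + s * e2) = e1 * (r * d1 + s * d2) + s * (d1 * e2 - d2 * e1)"
      "d2 * (r * e1 + s * e2) = e2 * (r * d1 + s * d2) - r * (d1 * e2 - d2 * e1)"
      by (simp_all add: algebra_simps)
    then have "r * e1 + s * e2 = 0"
      using ne by (auto simp only: 1 par mult_zero_right diff_zero add_0_right mult_eq_0_iff)
    moreover have "B u u - B u x = (B v u - B v x) + (r * e1 + s * e2)"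
      by (simp add: defs B_def algebra_simps)
    ultimately show ?thesis using assms(5) by simp
  qed
qed

section \<open>Exclusion of the three nested structures\<close>

text \<open>If the star at \<open>v\<close> is degenerate, its leaves share \<open>X1\<close> and
  the star at \<open>w\<close> is nondegenerate, against \<open>fibre_dot\<close> or
  \<open>parabola_line\<close>. The same two lemmas refute a degenerate star at \<open>w\<close>. If
  both stars are nondegenerate, \<open>line\<close> leaves no type for the cherry at
  \<open>u\<close>.\<close>

lemma no_nested_stars:
  assumes V: "v \<in> V" "w \<in> V" "u \<in> V" "x \<in> V" "y \<in> V" and dist: "distinct [v, w, u, x, y]"
    and v: "D v w = D v u" "D v w = D v x" "D v w = D v y"
    and w: "D w u = D w x" "D w u = D w y"
    and u: "D u x = D u y"
  shows False
proof -
  have ne: "w \<noteq> u" "w \<noteq> x" "w \<noteq> y" "u \<noteq> x" "u \<noteq> y" "x \<noteq> y"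
    using dist by auto
  have bits: "B v w = B w w \<longleftrightarrow> B v p = B p p" "B v w = B v v \<longleftrightarrow> B v p = B v v" "dot v w \<longleftrightarrow> dot v p"
    if "D v w = D v p" for v w p using that by (auto simp: D_def dot_def)
  \<comment> \<open>The centre of a degenerate cherry differs from the leaves in \<open>X1\<close>,
    so a star within a plane of constant \<open>X1\<close> is nondegenerate.\<close>
  have wdot: "dot w u \<and> B w u = B w x \<and> B w u = B w y" if "X1 w = X1 u"
  proof -
    have "D w u = D w y \<Longrightarrow> B w u = B w y" if "dot w u" using that \<open>X1 w = X1 u\<close>
      by (cases rule: cherry_cases[OF V(2,3,5) ne(5) w(2)]) (auto simp: dot_def)
    with that show ?thesis
      using w by (cases rule: cherry_cases[OF V(2-4) ne(4) w(1)]) auto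
  qed
  show False
  proof (cases rule: cherry_cases[OF V(1-3) ne(1) v(1), case_names dot out "in"])
    case out
    have "X1 w = X1 x"
      using v(2) out by (cases rule: cherry_cases[OF V(1,2,4) ne(2) v(2)]) (auto simp: dot_def)
    moreover have "B v x = B v v" using bits[OF v(2)] out by simp
    ultimately show False
      using fibre_dot[of u x w v] out V ne wdot by (auto simp: dot_def)
  next
    case "in"
    have "X1 w = X1 x"
      using "in" by (cases rule: cherry_cases[OF V(1,2,4) ne(2) v(2)]) (auto simp: dot_def)
    moreover have "X1 w = X1 y"
      using "in" by (cases rule: cherry_cases[OF V(1,2,5) ne(3) v(3)]) (auto simp: dot_def)
    moreover have "B v x = B x x" "B v y = B y y" using bits[OF v(2)] bits[OF v(3)] "in" by simp_all
    ultimately show False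
      using parabola_line[of u x y v w] "in" V ne wdot by (auto simp: dot_def)
  next
    case vdot: dot
    have Bv: "B v w = B v x" "B v w = B v y"
      using vdot by (rule_tac [1] cherry_cases[OF V(1,2,4) ne(2) v(2)],
        rule_tac [4] cherry_cases[OF V(1,2,5) ne(3) v(3)]) (auto simp: dot_def)
    show False
    proof (cases rule: cherry_cases[OF V(2-4) ne(4) w(1), case_names dot out "in"])
      case out
      have "X1 u = X1 y"
        using out by (cases rule: cherry_cases[OF V(2,3,5) ne(5) w(2)]) (auto simp: dot_def)
      then show False
        using fibre_dot[of x y u v] out V ne vdot Bv
        by (cases rule: cherry_cases[OF V(3-5) ne(6) u]) (auto simp: dot_def)
    next
      case "in"
      have "X1 u = X1 y"
        using "in" by (cases rule: cherry_cases[OF V(2,3,5) ne(5) w(2)]) (auto simp: dot_def)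
      moreover have "B w y = B y y" using bits(1)[OF w(2)] "in"(3) by simp
      moreover have "B v u = B v x" "B v u = B v y" using vdot(3) Bv by simp_all
      ultimately show False
        using parabola_line[OF V(3-5) "in"(2) _ "in"(3,4)] ne by blast
    next
      case wdot: dot
      have Bw: "B w u = B w y"
        using wdot by (cases rule: cherry_cases[OF V(2,3,5) ne(5) w(2)]) (auto simp: dot_def)
      have z: "X1 v = X1 w \<longrightarrow> X2 v \<noteq> X2 w" using vdot by (simp add: dot_def)
      have "B v u = B v x" "B v u = B v y" using vdot(3) Bv by simp_all
      note l = line[OF V(4,5) ne(6) z this wdot(3) Bw]
      show False
      proof (cases rule: cherry_cases[OF V(3-5) ne(6) u, case_names dot out "in"])
        case dot
        then show False using l(1) by (simp add: dot_def)
      qed (use l(2) in auto)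
    qed
  qed
qed

text \<open>Any degeneracy makes \<open>X1\<close> agree on \<open>a\<close>, \<open>a'\<close> and
  on \<open>b\<close>, \<open>b'\<close>, which \<open>fibre_dot\<close> or the factorisation
  \<open>zero\<close> refutes. Otherwise, in the first two coordinates, \<open>b - v\<close> and
  \<open>b - b'\<close> are orthogonal to \<open>a - a'\<close>, and \<open>a - v\<close> is
  orthogonal to \<open>b - b'\<close>. So \<open>a - v\<close> and \<open>b - v\<close> are
  perpendicular, which the bit \<open>T\<close> forbids.\<close>

lemma no_star_over_grid:
  assumes V: "v \<in> V" "a \<in> V" "a' \<in> V" "b \<in> V" "b' \<in> V" and dist: "distinct [v, a, a', b, b']"
    and v: "D v a = D v a'" "D v a = D v b" "D v a = D v b'"
    and a: "D a b = D a b'" "D a b = D a' b" "D a b = D a' b'"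
  shows False
proof -
  have ne: "a \<noteq> a'" "a \<noteq> b" "a \<noteq> b'" "b \<noteq> b'"
    using dist by auto
  have bits: "B p q = B p p \<longleftrightarrow> B p' q' = B p' p'" "B p q = B q q \<longleftrightarrow> B p' q' = B q' q'"
    "X1 p = X1 q \<longleftrightarrow> X1 p' = X1 q'" "X2 p = X2 q \<longleftrightarrow> X2 p' = X2 q'"
    "dot p q \<longleftrightarrow> dot p' q'" "T ((X2 q - X2 p) / (X1 q - X1 p)) = T ((X2 q' - X2 p') / (X1 q' - X1 p'))"
    if "D p q = D p' q'" for p q p' q' using that by (auto simp: D_def dot_def)
  have a': "D a' b = D a' b'" using a by simp
  have b: "D b a = D b a'" using D_swap[OF a(2)] .
  note va = cherry_cases[OF V(1-3) ne(1) v(1)]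
  note vb = cherry_cases[OF V(1,2,4) ne(2) v(2)]
  note vb' = cherry_cases[OF V(1,2,5) ne(3) v(3)]
  note ab = cherry_cases[OF V(2,4,5) ne(4) a(1)]
  note ab' = cherry_cases[OF V(3-5) ne(4) a']
  note ba = cherry_cases[OF V(4,2,3) ne(1) b]
  have zero: "X2 a = X2 a' \<or> X2 b = X2 b'"
    if "X1 a = X1 a'" "X1 b = X1 b'" "B a b - B a b' = B a' b - B a' b'"
  proof -
    have "(X2 a - X2 a') * (X2 b - X2 b') = (B a b - B a b') - (B a' b - B a' b')"
      using that(1,2) by (simp add: B_def algebra_simps)
    then show ?thesis using that(3) by simp
  qed
  show False
  proof (cases rule: va[case_names dot out "in"])
    case out
    have "X1 a = X1 b" "X1 a = X1 b'"
      using out by (rule_tac [1] vb, rule_tac [4] vb') (auto simp: dot_def)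
    moreover have "B v b = B v v" "B v b' = B v v" using bits[OF v(2)] bits[OF v(3)] out by simp_all
    moreover from \<open>X1 a = X1 b\<close> have "dot a b" "B a b = B a b'"
      by (rule_tac [1] ab, rule_tac [4] ab) auto
    ultimately show False
      using fibre_dot[of b b' a v] out V ne by (auto simp: dot_def)
  next
    case "in"
    have X1: "X1 a = X1 b" "X1 a = X1 b'"
      using "in" by (rule_tac [1] vb, rule_tac [4] vb') (auto simp: dot_def)
    have Bv: "B v b = B b b" "B v b' = B b' b'" using bits[OF v(2)] bits[OF v(3)] "in" by simp_all
    have 1: "B a b = B a b'"
      by (rule ab) (use X1 in auto)
    have 2: "B a' b = B a' b'"
      by (rule ab') (use X1 "in"(2) in auto)
    have same: "p = q" if "X1 p = X1 q" "X2 p = X2 q" "B v p = B p p" "B v q = B q q" "p \<in> V" "q \<in> V" for p q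
      using inj[of p q] that by (simp add: B_def)
    have "X2 a = X2 a' \<or> X2 b = X2 b'"
      by (rule zero) (use X1 "in"(2) 1 2 in simp_all)
    then show False
      using same[OF "in"(2) _ "in"(3,4) V(2,3)] same[OF _ _ Bv V(4,5)] X1 ne by auto
  next
    case vdot: dot
    have Bv: "B v a = B v b" "B v a = B v b'"
      using vdot by (rule_tac [1] vb, rule_tac [4] vb') (auto simp: dot_def)
    have zv: "X2 p = X2 q \<Longrightarrow> X1 p = X1 q \<Longrightarrow> B v p = B v q \<Longrightarrow> p \<in> V \<Longrightarrow> q \<in> V \<Longrightarrow> p = q" for p q
      using inj[of p q] by (simp add: B_def)
    show False
    proof (cases "dot a b")
      case False
      have X1: "X1 b = X1 b'"
        by (rule ab) (use False in auto)
      have X1': "X1 a = X1 a'"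
        by (rule ba) (use False in \<open>auto simp: dot_def B_commute\<close>)
      have "B a b = B a a \<or> B a b = B b b"
        by (rule ab) (use False in auto)
      then have "B a b - B a b' = B a' b - B a' b'"
        using bits(1,2)[OF a(1)] bits(1,2)[OF a(2)] bits(1,2)[OF a(3)] by auto
      then have "X2 a = X2 a' \<or> X2 b = X2 b'"
        using zero X1 X1' by simp
      then show False
        using zv[of a a'] zv[of b b'] X1 X1' V ne vdot Bv by auto
    next
      case True
      have Ba: "B a b = B a b'"
        by (rule ab) (use True in \<open>auto simp: dot_def\<close>)
      have Ba': "B a' b = B a' b'"
        by (rule ab') (use True bits(5)[OF a(2)] in \<open>auto simp: dot_def\<close>)
      have Bb: "B a b = B a' b"
        by (rule ba) (use True in \<open>auto simp: dot_def B_commute\<close>)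
      define d e where "d = X1 a - X1 a'" and "e = X2 a - X2 a'"
      define f g where "f = X1 b - X1 b'" and "g = X2 b - X2 b'"
      have de: "d \<noteq> 0 \<or> e \<noteq> 0"
        using zv[of a a'] V ne vdot by (auto simp: d_def e_def)
      have fg: "f \<noteq> 0 \<or> g \<noteq> 0"
        using zv[of b b'] V ne vdot Bv by (auto simp: f_def g_def)
      define r s where "r = X1 a - X1 v" and "s = X2 a - X2 v"
      define t u where "t = X1 b - X1 v" and "u = X2 b - X2 v"
      have 1: "d * f + e * g = 0"
      proof -
        have "d * f + e * g = (B a b - B a b') - (B a' b - B a' b')"
          by (simp add: d_def e_def f_def g_def B_def algebra_simps)
        then show ?thesis using Ba Ba' by simp
      qed
      have 2: "d * t + e * u = 0"
      proof -
        have "d * t + e * u = (B a b - B a' b) - (B v a - B v a')"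
          by (simp add: d_def e_def t_def u_def B_def algebra_simps)
        then show ?thesis using Bb vdot by simp
      qed
      have 3: "f * r + g * s = 0"
      proof -
        have "f * r + g * s = (B a b - B a b') - (B v b - B v b')"
          by (simp add: f_def g_def r_def s_def B_def algebra_simps)
        then show ?thesis using Ba Bv by simp
      qed
      \<comment> \<open>One identity for each choice of a nonzero coordinate of
        \<open>a - a'\<close> and of \<open>b - b'\<close>: multiplied by both, the dot product is a
        combination of the three relations.\<close>
      have "d * (f * (r * t + s * u)) = (d*t + e*u) * (f*r) - e*u * (f*r + g*s) + s*u * (d*f + e*g)"
        "d * (g * (r * t + s * u)) = (d*t + e*u) * (g*r) + d*u * (f*r + g*s) - u*r * (d*f + e*g)"
        "e * (f * (r * t + s * u)) = (d*t + e*u) * (f*s) + e*t * (f*r + g*s) - s*t * (d*f + e*g)"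
        "e * (g * (r * t + s * u)) = (f*r + g*s) * (e*u) - f*r * (d*t + e*u) + r*t * (d*f + e*g)"
        by (simp_all add: algebra_simps)
      then have perp: "r * t + s * u = 0"
        using de fg by (auto simp only: 1 2 3 mult_zero_left mult_zero_right diff_0_right add_0_right mult_eq_0_iff)
      \<comment> \<open>The colour records which coordinates differ; this rules out perpendicular
        directions parallel to the axes.\<close>
      have rt: "r = 0 \<longleftrightarrow> t = 0" "s = 0 \<longleftrightarrow> u = 0"
        unfolding r_def s_def t_def u_def right_minus_eq using bits(3,4)[OF v(2)] by metis+
      have "\<not> (r = 0 \<and> s = 0)"
        using vdot by (auto simp: dot_def r_def s_def)
      with perp rt have nz: "r \<noteq> 0" "s \<noteq> 0" "t \<noteq> 0"
        by auto
      then have "T (s / r) \<noteq> T (u / t)"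
        using T_orthogonal[OF V(1,2,4)] perp by (simp add: r_def s_def t_def u_def)
      then show False
        using bits(6)[OF v(2)] by (simp add: r_def s_def t_def u_def)
    qed
  qed
qed

text \<open>In the nondegenerate case \<open>a\<close> and \<open>a'\<close> give the two planes of
  \<open>line\<close>, which leaves no type for the cherry at \<open>x\<close>. Type
  \<open>out\<close> contradicts \<open>fibre_dot\<close>. For type \<open>in\<close>, the cherry at
  \<open>x\<close> with leaves \<open>a\<close>, \<open>a'\<close> gives
  \<open>X1 a = X1 a'\<close>, and the mixed difference factors, so that \<open>a = a'\<close> or
  \<open>x = y\<close>.\<close>

lemma no_grid_over_cherry:
  assumes V: "a \<in> V" "a' \<in> V" "x \<in> V" "y \<in> V" "z \<in> V" and dist: "distinct [a, a', x, y, z]"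
    and a: "D a x = D a y" "D a x = D a z" "D a x = D a' x" "D a x = D a' y" "D a x = D a' z"
    and x: "D x y = D x z"
  shows False
proof -
  have ne: "a \<noteq> a'" "x \<noteq> y" "x \<noteq> z" "y \<noteq> z"
    using dist by auto
  have bits: "B p q = B p p \<longleftrightarrow> B p' q' = B p' p'" "B p q = B q q \<longleftrightarrow> B p' q' = B q' q'"
    "dot p q \<longleftrightarrow> dot p' q'"
    if "D p q = D p' q'" for p q p' q' using that by (auto simp: D_def dot_def)
  have a': "D a' x = D a' y" "D a' x = D a' z" using a by simp_all
  note ay = cherry_cases[OF V(1,3,4) ne(2) a(1)]
  note az = cherry_cases[OF V(1,3,5) ne(3) a(2)]
  note ay' = cherry_cases[OF V(2-4) ne(2) a'(1)]
  note az' = cherry_cases[OF V(2,3,5) ne(3) a'(2)]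
  note xa = cherry_cases[OF V(3,1,2) ne(1) D_swap[OF a(3)]]
  note xy = cherry_cases[OF V(3-5) ne(4) x]
  show False
  proof (cases rule: ay[case_names dot out "in"])
    case dot
    have B: "B a x = B a y" "B a x = B a z"
      using dot by (rule_tac [1] ay, rule_tac [4] az) (auto simp: dot_def)
    have B': "B a' x = B a' y" "B a' x = B a' z"
      using dot bits(3)[OF a(3)] by (rule_tac [1] ay', rule_tac [4] az') (auto simp: dot_def)
    have Bx: "B a x = B a' x"
      by (rule xa) (use dot in \<open>auto simp: dot_def B_commute\<close>)
    have "X1 a = X1 a' \<longrightarrow> X2 a \<noteq> X2 a'"
      using Bx inj[of a a'] V ne by (auto simp: B_def)
    note l = line[OF V(4,5) ne(4) this B B']
    show False
      by (rule xy) (use l in \<open>auto simp: dot_def\<close>)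
  next
    case out
    have X1: "X1 x = X1 z"
      using out by (rule_tac az) (auto simp: dot_def)
    have Ba: "B a z = B a a"
      using out bits(1)[OF a(2)] by simp
    have "dot x y" "B x y = B x z"
      using out X1 by (rule_tac [1] xy, rule_tac [4] xy) auto
    then show False
      using fibre_dot[of y z x a] out X1 Ba V ne by (auto simp: dot_def)
  next
    case "in"
    have X1': "X1 a = X1 a'"
      by (rule xa) (use "in" in \<open>auto simp: dot_def B_commute\<close>)
    have B': "B a' x = B x x" "B a' y = B y y"
      using bits(2)[OF a(3)] bits(2)[OF a(4)] "in" by auto
    have "(X2 a - X2 a') * (X2 x - X2 y) = (B a x - B a' x) - (B a y - B a' y)"
      using X1' by (simp add: B_def algebra_simps)
    then have "X2 a = X2 a' \<or> X2 x = X2 y" using B' "in" by simp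
    moreover have "X3 a = X3 a'" if "X2 a = X2 a'"
    proof -
      have "B a x = B a' x" using B' "in" by simp
      then show ?thesis using that X1' by (simp add: B_def)
    qed
    moreover have "X3 x = X3 y" if "X2 x = X2 y"
      using that "in" by (simp add: B_def)
    ultimately show False
      using inj V ne X1' "in" by metis
  qed
qed

end

subsection \<open>Sets of five vertices with at most four colours\<close>

definition colors :: "('v \<Rightarrow> 'v \<Rightarrow> 'c) \<Rightarrow> 'v set \<Rightarrow> 'c set"
  where "colors f S = {f x y | x y. x \<in> S \<and> y \<in> S \<and> x \<noteq> y}"

definition cross :: "('v \<Rightarrow> 'v \<Rightarrow> 'c) \<Rightarrow> 'v set \<Rightarrow> 'v set \<Rightarrow> 'c set"
  where "cross f A B = {f x y | x y. x \<in> A \<and> y \<in> B}"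

text \<open>The properties of the digit colouring on which the count of colours rests. The last
  clause of \<open>split\<close> forbids, across the split, a \<open>K_4\<close> whose three perfect
  matchings are all monochromatic.\<close>

locale splitting_coloring =
  fixes f :: "'v \<Rightarrow> 'v \<Rightarrow> 'c" and V :: "'v set"
  assumes sym: "f x y = f y x"
    and no_cherry: "\<lbrakk>x \<in> V; y \<in> V; z \<in> V; w \<in> V; x \<noteq> y; z \<noteq> w; x \<noteq> z; x \<noteq> w; f x y = f z w\<rbrakk>
      \<Longrightarrow> f x z \<noteq> f x w"
    and split: "\<lbrakk>S \<subseteq> V; finite S; card S \<ge> 2\<rbrakk> \<Longrightarrow> \<exists>A B. A \<noteq> {} \<and> B \<noteq> {} \<and> A \<inter> B = {} \<and> A \<union> B = S \<and>
      cross f A B \<inter> (colors f A \<union> colors f B) = {} \<and>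
      (\<forall>a\<in>A. \<forall>a'\<in>A. \<forall>b\<in>B. \<forall>b'\<in>B. a \<noteq> a' \<longrightarrow> b \<noteq> b' \<longrightarrow> f a a' = f b b' \<longrightarrow> f a b = f a' b' \<longrightarrow> f a b' \<noteq> f a' b)"
begin

lemma finite_colors: "finite S \<Longrightarrow> finite (colors f S)"
  by (rule finite_subset[of _ "(\<lambda>(x, y). f x y) ` (S \<times> S)"]) (auto simp: colors_def)

lemma finite_cross: "finite A \<Longrightarrow> finite B \<Longrightarrow> finite (cross f A B)"
  by (rule finite_subset[of _ "(\<lambda>(x, y). f x y) ` (A \<times> B)"]) (auto simp: cross_def)

lemma card_cross_pos: "finite A \<Longrightarrow> finite B \<Longrightarrow> A \<noteq> {} \<Longrightarrow> B \<noteq> {} \<Longrightarrow> card (cross f A B) \<ge> 1"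
  using finite_cross[of A B] by (simp add: Suc_le_eq card_gt_0_iff) (auto simp: cross_def)

lemma cross_commute: "cross f A B = cross f B A"
  unfolding cross_def using sym by blast

lemma card_cross_1:
  assumes "card (cross f A B) = 1" "a \<in> A" "b \<in> B" "a' \<in> A" "b' \<in> B"
  shows "f a b = f a' b'"
proof -
  have "f a b \<in> cross f A B" "f a' b' \<in> cross f A B"
    using assms by (auto simp: cross_def)
  with assms(1) show ?thesis by (metis card_1_singletonE singletonD)
qed

lemma colors_pair: "a \<noteq> b \<Longrightarrow> colors f {a, b} = {f a b}"
  using sym by (auto simp: colors_def)

lemma colors_singleton: "colors f {a} = {}"
  by (auto simp: colors_def)

lemma colors_Un: "colors f (A \<union> B) \<supseteq> cross f A B \<union> (colors f A \<union> colors f B)" if "A \<inter> B = {}"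
  using that by (auto simp: colors_def cross_def) blast+

lemma split_card:
  assumes "S \<subseteq> V" "finite S" "card S \<ge> 2"
  obtains A B where "A \<noteq> {}" "B \<noteq> {}" "A \<inter> B = {}" "A \<union> B = S" "card B \<le> card A" "card A + card B = card S"
    "card (cross f A B) + card (colors f A \<union> colors f B) \<le> card (colors f S)"
    "\<And>a a' b b'. a \<in> A \<Longrightarrow> a' \<in> A \<Longrightarrow> b \<in> B \<Longrightarrow> b' \<in> B \<Longrightarrow> a \<noteq> a' \<Longrightarrow> b \<noteq> b' \<Longrightarrow> f a a' = f b b' \<Longrightarrow>
      f a b = f a' b' \<Longrightarrow> f a b' \<noteq> f a' b"
proof -
  obtain A B where AB: "A \<noteq> {}" "B \<noteq> {}" "A \<inter> B = {}" "A \<union> B = S"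
      "cross f A B \<inter> (colors f A \<union> colors f B) = {}"
    and st: "\<forall>a\<in>A. \<forall>a'\<in>A. \<forall>b\<in>B. \<forall>b'\<in>B. a \<noteq> a' \<longrightarrow> b \<noteq> b' \<longrightarrow> f a a' = f b b' \<longrightarrow> f a b = f a' b' \<longrightarrow> f a b' \<noteq> f a' b"
    using split[OF assms] by (elim exE conjE) (rule that)
  have fin: "finite A" "finite B"
    using AB(4) assms(2) by auto
  have "card (cross f A B) + card (colors f A \<union> colors f B) = card (cross f A B \<union> (colors f A \<union> colors f B))"
    using AB(5) fin by (intro card_Un_disjoint[symmetric]) (auto simp: finite_cross finite_colors)
  also have "\<dots> \<le> card (colors f S)"
    using colors_Un[OF AB(3)] AB(4) assms(2) by (intro card_mono finite_colors) auto
  finally have c: "card (cross f A B) + card (colors f A \<union> colors f B) \<le> card (colors f S)" .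
  have card: "card A + card B = card S"
    using AB fin by (metis card_Un_disjoint)
  show ?thesis
  proof (cases "card B \<le> card A")
    case True
    then show ?thesis using that[of A B] AB st c card by blast
  next
    case False
    show ?thesis
    proof (rule that[of B A])
      show "card (cross f B A) + card (colors f B \<union> colors f A) \<le> card (colors f S)"
        using c by (simp add: cross_commute[of B] Un_commute)
      show "f a b' \<noteq> f a' b" if "a \<in> B" "a' \<in> B" "b \<in> A" "b' \<in> A" "a \<noteq> a'" "b \<noteq> b'" "f a a' = f b b'" "f a b = f a' b'"
        for a a' b b'
        using st[rule_format, of b b' a a'] that by (metis sym)
    qed (use AB card False in auto)
  qed
qed

text \<open>The cross edges form a 4-cycle: \<open>no_cherry\<close> separates adjacent edges, and
  by \<open>striped\<close> the two opposite pairs are not both monochromatic.\<close>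

lemma three_cross_colors:
  assumes V: "a \<in> V" "a' \<in> V" "b \<in> V" "b' \<in> V" and ne: "a \<noteq> a'" "b \<noteq> b'" "a \<noteq> b" "a \<noteq> b'" "a' \<noteq> b" "a' \<noteq> b'"
    and eq: "f a a' = f b b'" and striped: "f a b = f a' b' \<Longrightarrow> f a b' \<noteq> f a' b"
    and C: "{f a b, f a b', f a' b, f a' b'} \<subseteq> C" "finite C"
  shows "card C \<ge> 3"
proof -
  have 1: "f a b \<noteq> f a b'" using no_cherry[of a a' b b'] V ne eq by blast
  have 2: "f a' b \<noteq> f a' b'" using no_cherry[of a' a b b'] V ne eq by (metis sym)
  have 3: "f a b \<noteq> f a' b" using no_cherry[of b b' a a'] V ne eq by (metis sym)
  have 4: "f a b' \<noteq> f a' b'" using no_cherry[of b' b a a'] V ne eq by (metis sym)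
  have "\<exists>p q r. {p, q, r} \<subseteq> C \<and> p \<noteq> q \<and> p \<noteq> r \<and> q \<noteq> r"
    using 1 2 3 4 striped C by (cases "f a b = f a' b'") auto
  then obtain p q r where "{p, q, r} \<subseteq> C" "p \<noteq> q" "p \<noteq> r" "q \<noteq> r" by blast
  then show ?thesis
    using card_mono[OF C(2), of "{p, q, r}"] by simp
qed

text \<open>The split is 2 + 1, with one colour inside the pair and at least one across. If there
  are only two in all, the cross edges are the cherry.\<close>

lemma card_3_colors:
  assumes "S \<subseteq> V" "card S = 3"
  shows "card (colors f S) \<ge> 2"
    and "card (colors f S) \<le> 2 \<Longrightarrow> \<exists>u x y. S = {u, x, y} \<and> f u x = f u y"
proof -
  have fin: "finite S" using assms(2) by (metis card.infinite zero_neq_numeral)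
  obtain A B where AB: "A \<noteq> {}" "B \<noteq> {}" "A \<inter> B = {}" "A \<union> B = S" "card B \<le> card A" "card A + card B = card S"
    "card (cross f A B) + card (colors f A \<union> colors f B) \<le> card (colors f S)"
    by (rule split_card[OF assms(1) fin]) (use assms(2) in \<open>auto intro: that\<close>)
  have fAB: "finite A" "finite B" using AB(4) fin by auto
  have "card B > 0" using AB(2) fAB by (simp add: card_gt_0_iff)
  then have "card B = 1" "card A = 2" using AB(5,6) assms(2) by auto
  then obtain u x y where u: "B = {u}" "A = {x, y}" "x \<noteq> y"
    by (auto simp: card_1_singleton_iff card_2_iff)
  have inner: "card (colors f A \<union> colors f B) = 1"
    using u by (simp add: colors_pair colors_singleton)
  have "card (cross f A B) \<ge> 1" using card_cross_pos fAB AB by blast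
  with inner AB(7) show "card (colors f S) \<ge> 2" by simp
  assume "card (colors f S) \<le> 2"
  with inner AB(7) \<open>card (cross f A B) \<ge> 1\<close> have "card (cross f A B) = 1" by simp
  then have "f x u = f y u" using card_cross_1 u by blast
  then show "\<exists>u x y. S = {u, x, y} \<and> f u x = f u y"
    using u AB(4) sym by (intro exI[of _ u] exI[of _ x] exI[of _ y]) auto
qed

text \<open>A split 3 + 1 gives at least 2 + 1 colours. In a split 2 + 2, inner edges of equal
  colour force three cross colours; otherwise there are at least 2 + 1. Equality makes the cross
  edges monochromatic.\<close>

lemma card_4_colors:
  assumes "S \<subseteq> V" "card S = 4"
  shows "card (colors f S) \<ge> 3"
    and "card (colors f S) \<le> 3 \<Longrightarrow>
      (\<exists>w u x y. S = {w, u, x, y} \<and> f w u = f w x \<and> f w u = f w y \<and> f u x = f u y) \<or>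
      (\<exists>a a' b b'. S = {a, a', b, b'} \<and> f a b = f a b' \<and> f a b = f a' b \<and> f a b = f a' b')"
proof -
  have fin: "finite S" using assms(2) by (metis card.infinite zero_neq_numeral)
  have "card S \<ge> 2" using assms(2) by simp
  obtain A B where AB: "A \<noteq> {}" "B \<noteq> {}" "A \<inter> B = {}" "A \<union> B = S" "card B \<le> card A" "card A + card B = card S"
    "card (cross f A B) + card (colors f A \<union> colors f B) \<le> card (colors f S)"
    and st: "\<And>a a' b b'. a \<in> A \<Longrightarrow> a' \<in> A \<Longrightarrow> b \<in> B \<Longrightarrow> b' \<in> B \<Longrightarrow> a \<noteq> a' \<Longrightarrow> b \<noteq> b' \<Longrightarrow> f a a' = f b b' \<Longrightarrow>
      f a b = f a' b' \<Longrightarrow> f a b' \<noteq> f a' b"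
    by (rule split_card[OF assms(1) fin \<open>card S \<ge> 2\<close>]) (rule that; assumption)
  have fAB: "finite A" "finite B" using AB(4) fin by auto
  have cr: "card (cross f A B) \<ge> 1" using card_cross_pos fAB AB by blast
  have "card B > 0" using AB(2) fAB by (simp add: card_gt_0_iff)
  then consider (31) "card A = 3" "card B = 1" | (22) "card A = 2" "card B = 2"
    using AB(5,6) assms(2) by linarith
  then have "card (colors f S) \<ge> 3 \<and> (card (colors f S) \<le> 3 \<longrightarrow>
      (\<exists>w u x y. S = {w, u, x, y} \<and> f w u = f w x \<and> f w u = f w y \<and> f u x = f u y) \<or>
      (\<exists>a a' b b'. S = {a, a', b, b'} \<and> f a b = f a b' \<and> f a b = f a' b \<and> f a b = f a' b'))"
  proof cases
    case 31
    then obtain w where w: "B = {w}" by (auto simp: card_1_singleton_iff)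
    have A: "A \<subseteq> V" using AB(4) assms(1) by auto
    have inner: "colors f A \<union> colors f B = colors f A"
      using w by (simp add: colors_singleton)
    have "card (colors f A) \<ge> 2" by (rule card_3_colors(1)[OF A 31(1)])
    then have ge: "card (colors f S) \<ge> 3" using AB(7) cr inner by simp
    show ?thesis
    proof (intro conjI impI ge disjI1)
      assume "card (colors f S) \<le> 3"
      then have "card (cross f A B) = 1" "card (colors f A) \<le> 2"
        using AB(7) cr inner \<open>card (colors f A) \<ge> 2\<close> by auto
      then obtain u x y where u: "A = {u, x, y}" "f u x = f u y"
        using card_3_colors(2)[OF A 31(1)] by blast
      have "f w u = f w x \<and> f w u = f w y"
        unfolding sym[of w u] sym[of w x] sym[of w y]
        by (intro conjI card_cross_1[OF \<open>card (cross f A B) = 1\<close>]) (use u(1) w in auto)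
      then show "\<exists>w u x y. S = {w, u, x, y} \<and> f w u = f w x \<and> f w u = f w y \<and> f u x = f u y"
        using u(2) by (rule_tac exI[of _ w], rule_tac exI[of _ u], rule_tac exI[of _ x], rule_tac exI[of _ y]) (use u(1) w AB(4) in auto)
    qed
  next
    case 22
    then obtain a a' b b' where ab: "A = {a, a'}" "a \<noteq> a'" "B = {b, b'}" "b \<noteq> b'"
      by (auto simp: card_2_iff)
    have inner: "card (colors f A \<union> colors f B) = (if f a a' = f b b' then 1 else 2)"
      using ab by (simp add: colors_pair)
    show ?thesis
    proof (cases "f a a' = f b b'")
      case True
      have "card (cross f A B) \<ge> 3"
        by (rule three_cross_colors[of a a' b b'])
          (use ab AB(3,4) assms(1) True st finite_cross[OF fAB] in \<open>auto simp: cross_def\<close>)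
      then show ?thesis using AB(7) inner True by simp
    next
      case False
      have "card (colors f S) \<ge> 3" using AB(7) inner False cr by simp
      moreover have "\<exists>a a' b b'. S = {a, a', b, b'} \<and> f a b = f a b' \<and> f a b = f a' b \<and> f a b = f a' b'"
        if "card (colors f S) \<le> 3"
      proof -
        have "card (cross f A B) = 1"
          using that AB(7) inner False cr by simp
        then have "f a b = f a b' \<and> f a b = f a' b \<and> f a b = f a' b'"
          using ab(1,3) by (intro conjI) (erule card_cross_1; simp)+
        moreover have "S = {a, a', b, b'}" using ab(1,3) AB(4) by auto
        ultimately show ?thesis by blast
      qed
      ultimately show ?thesis by blast
    qed
  qed
  then show "card (colors f S) \<ge> 3"
    and "card (colors f S) \<le> 3 \<Longrightarrow>
      (\<exists>w u x y. S = {w, u, x, y} \<and> f w u = f w x \<and> f w u = f w y \<and> f u x = f u y) \<or>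
      (\<exists>a a' b b'. S = {a, a', b, b'} \<and> f a b = f a b' \<and> f a b = f a' b \<and> f a b = f a' b')"
    by blast+
qed

text \<open>With at most 4 colours the cross edges must be monochromatic and the larger part
  extremal. In a split 3 + 2 the edge inside \<open>B\<close> has a new colour, since otherwise
  three cross colours would bring the total to five.\<close>

lemma card_5_colors:
  assumes "S \<subseteq> V" "card S = 5" "card (colors f S) \<le> 4"
  obtains (nested_stars) v w u x y where "S = {v, w, u, x, y}" "f v w = f v u" "f v w = f v x" "f v w = f v y"
      "f w u = f w x" "f w u = f w y" "f u x = f u y"
  | (star_over_grid) v a a' b b' where "S = {v, a, a', b, b'}" "f v a = f v a'" "f v a = f v b" "f v a = f v b'"
      "f a b = f a b'" "f a b = f a' b" "f a b = f a' b'"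
  | (grid_over_cherry) a a' x y z where "S = {a, a', x, y, z}" "f a x = f a y" "f a x = f a z"
      "f a x = f a' x" "f a x = f a' y" "f a x = f a' z" "f x y = f x z"
proof -
  have fin: "finite S" using assms(2) by (metis card.infinite zero_neq_numeral)
  have "card S \<ge> 2" using assms(2) by simp
  obtain A B where AB: "A \<noteq> {}" "B \<noteq> {}" "A \<inter> B = {}" "A \<union> B = S" "card B \<le> card A" "card A + card B = card S"
    "card (cross f A B) + card (colors f A \<union> colors f B) \<le> card (colors f S)"
    and st: "\<And>a a' b b'. a \<in> A \<Longrightarrow> a' \<in> A \<Longrightarrow> b \<in> B \<Longrightarrow> b' \<in> B \<Longrightarrow> a \<noteq> a' \<Longrightarrow> b \<noteq> b' \<Longrightarrow> f a a' = f b b' \<Longrightarrow>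
      f a b = f a' b' \<Longrightarrow> f a b' \<noteq> f a' b"
    by (rule split_card[OF assms(1) fin \<open>card S \<ge> 2\<close>]) (rule that; assumption)
  have fAB: "finite A" "finite B" using AB(4) fin by auto
  have cr: "card (cross f A B) \<ge> 1" using card_cross_pos fAB AB by blast
  have A: "A \<subseteq> V" using AB(4) assms(1) by auto
  have "card B > 0" using AB(2) fAB by (simp add: card_gt_0_iff)
  then consider (41) "card A = 4" "card B = 1" | (32) "card A = 3" "card B = 2"
    using AB(5,6) assms(2) by linarith
  then show thesis
  proof cases
    case 41
    then obtain v where v: "B = {v}" by (auto simp: card_1_singleton_iff)
    have inner: "colors f A \<union> colors f B = colors f A"
      using v by (simp add: colors_singleton)
    have "card (colors f A) \<ge> 3" by (rule card_4_colors(1)[OF A 41(1)])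
    then have "card (cross f A B) = 1" and le: "card (colors f A) \<le> 3"
      using AB(7) cr inner assms(3) by auto
    then have vA: "f v a = f v a'" if "a \<in> A" "a' \<in> A" for a a'
      using card_cross_1[of A B] that v by (metis singletonI sym)
    from card_4_colors(2)[OF A 41(1) le] show thesis
    proof (elim disjE exE conjE)
      fix w u x y assume "A = {w, u, x, y}" "f w u = f w x" "f w u = f w y" "f u x = f u y"
      then show thesis
        using vA AB(4) v by (intro nested_stars[of v w u x y]) auto
    next
      fix a a' b b' assume "A = {a, a', b, b'}" "f a b = f a b'" "f a b = f a' b" "f a b = f a' b'"
      then show thesis
        using vA AB(4) v by (intro star_over_grid[of v a a' b b']) auto
    qed
  next
    case 32
    then obtain b b' where b: "B = {b, b'}" "b \<noteq> b'"
      by (auto simp: card_2_iff)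
    have A2: "card (colors f A) \<ge> 2" by (rule card_3_colors(1)[OF A 32(1)])
    have fb: "f b b' \<notin> colors f A"
    proof
      assume mem: "f b b' \<in> colors f A"
      then obtain a a' where a: "a \<in> A" "a' \<in> A" "a \<noteq> a'" "f a a' = f b b'"
        by (auto simp: colors_def)
      have "card (cross f A B) \<ge> 3"
        by (rule three_cross_colors[of a a' b b'])
          (use a b AB(3,4) assms(1) st finite_cross[OF fAB] in \<open>auto simp: cross_def\<close>)
      moreover have "colors f A \<union> colors f B = colors f A"
        using b mem by (auto simp: colors_pair)
      ultimately show False using AB(7) A2 assms(3) by simp
    qed
    have "card (colors f A \<union> colors f B) = Suc (card (colors f A))"
      using b fb fAB by (simp add: colors_pair finite_colors)
    then have cr1: "card (cross f A B) = 1" and "card (colors f A) \<le> 2"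
      using AB(7) A2 assms(3) cr by auto
    then obtain x y z where x: "A = {x, y, z}" "f x y = f x z"
      using card_3_colors(2)[OF A 32(1)] by blast
    have "f p q = f p' q'" if "p \<in> B" "p' \<in> B" "q \<in> A" "q' \<in> A" for p q p' q'
      unfolding sym[of p q] sym[of p' q'] by (rule card_cross_1[OF cr1 that(3,1,4,2)])
    then show thesis
      using x b AB(4) by (intro grid_over_cherry[of b b' x y z]) auto
  qed
qed

end

subsection \<open>The digit colouring\<close>

locale digits =
  fixes M m :: nat
  assumes M: "M > 1" and m: "m > 0"
begin

definition dig :: "nat \<Rightarrow> nat \<Rightarrow> nat"
  where "dig x j = x div M ^ j mod M"

text \<open>The most significant position at which \<open>x\<close> and \<open>y\<close> differ; the
  value is 0 for \<open>x = y\<close>.\<close>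

definition top_digit :: "nat \<Rightarrow> nat \<Rightarrow> nat"
  where "top_digit x y = (LEAST k. x div M ^ Suc k = y div M ^ Suc k)"

text \<open>The digits at the top position yield the split of a vertex set. The zeros among the
  signs yield \<open>no_cherry\<close>, and the signs themselves exclude the \<open>K_4\<close> with
  three monochromatic matchings.\<close>

definition E :: "nat \<Rightarrow> nat \<Rightarrow> nat \<times> nat \<times> nat \<times> int list"
  where "E x y = (top_digit x y, dig x (top_digit x y), dig y (top_digit x y),
    map (\<lambda>j. sgn (int (dig x j) - int (dig y j))) [0..<m])"

lemma div_eq_mono: "x div M ^ i = y div M ^ i \<Longrightarrow> i \<le> j \<Longrightarrow> x div M ^ j = y div M ^ j"
  by (metis div_mult2_eq le_add_diff_inverse power_add)

lemma dig_eq_if: "x div M ^ i = y div M ^ i \<Longrightarrow> i \<le> j \<Longrightarrow> dig x j = dig y j"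
  unfolding dig_def by (metis div_eq_mono)

context
  fixes x y assumes x: "x < M ^ m" and y: "y < M ^ m"
begin

lemma top_digit_less: "top_digit x y < m"
proof -
  have "x div M ^ Suc (m - 1) = y div M ^ Suc (m - 1)"
    using m x y by simp
  then have "top_digit x y \<le> m - 1"
    unfolding top_digit_def by (rule Least_le)
  with m show ?thesis by simp
qed

lemma div_Suc_top_digit: "x div M ^ Suc (top_digit x y) = y div M ^ Suc (top_digit x y)"
proof -
  have "x div M ^ Suc (m - 1) = y div M ^ Suc (m - 1)"
    using m x y by simp
  then show ?thesis
    unfolding top_digit_def by (rule LeastI)
qed

lemma div_top_digit_neq: "x \<noteq> y \<Longrightarrow> x div M ^ top_digit x y \<noteq> y div M ^ top_digit x y"
proof (cases "top_digit x y")
  case (Suc k)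
  then show ?thesis
    using not_less_Least[of k "\<lambda>k. x div M ^ Suc k = y div M ^ Suc k"] by (simp add: top_digit_def)
qed simp

lemma dig_top_digit_neq: 
  assumes "x \<noteq> y"
  shows "dig x (top_digit x y) \<noteq> dig y (top_digit x y)"
proof
  let ?k = "top_digit x y"
  assume "dig x ?k = dig y ?k"
  moreover have "x div M ^ ?k div M = y div M ^ ?k div M"
    using div_Suc_top_digit by (simp add: div_mult2_eq[symmetric] mult.commute)
  ultimately have "x div M ^ ?k = y div M ^ ?k"
    unfolding dig_def by (metis div_mult_mod_eq)
  with div_top_digit_neq assms show False by simp
qed

end

lemma top_digit_commute: "top_digit x y = top_digit y x"
  by (simp add: top_digit_def eq_commute)

lemma top_digit_eqI: "x div M ^ Suc k = y div M ^ Suc k \<Longrightarrow> x div M ^ k \<noteq> y div M ^ k \<Longrightarrow> top_digit x y = k"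
  unfolding top_digit_def by (rule Least_equality) (use div_eq_mono not_less_eq_eq in blast)+

lemma E_sgn:
  assumes "E x y = E x' y'" "j < m"
  shows "sgn (int (dig x j) - int (dig y j)) = sgn (int (dig x' j) - int (dig y' j))"
  using assms by (simp add: E_def)

lemma E_swap:
  assumes "E x y = E x' y'"
  shows "E y x = E y' x'"
proof -
  have "sgn (int (dig y j) - int (dig x j)) = sgn (int (dig y' j) - int (dig x' j))" if "j < m" for j
    using E_sgn[OF assms that] by (auto simp: sgn_if split: if_splits)
  then show ?thesis
    using assms by (auto simp: E_def top_digit_commute[of y x] top_digit_commute[of y' x'])
qed

lemma E_dig_eq_iff:
  assumes "E x y = E x' y'" "j < m"
  shows "dig x j = dig y j \<longleftrightarrow> dig x' j = dig y' j"
  using E_sgn[OF assms] by (auto simp: sgn_if split: if_splits)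

lemma E_top_digit: "E x y = E x' y' \<Longrightarrow> top_digit x y = top_digit x' y'"
  by (simp add: E_def)

lemma E_dig: "E x y = E x' y' \<Longrightarrow> dig x (top_digit x y) = dig x' (top_digit x y)" "E x y = E x' y' \<Longrightarrow> dig y (top_digit x y) = dig y' (top_digit x y)"
  by (auto simp: E_def)

text \<open>Equality of colours for unordered edges; \<open>E_swap\<close> makes the two directions
  of an edge equivalent.\<close>

definition same :: "nat \<Rightarrow> nat \<Rightarrow> nat \<Rightarrow> nat \<Rightarrow> bool"
  where "same x y z w \<longleftrightarrow> E x y = E z w \<or> E x y = E w z"

lemma same_top_digit: "same x y z w \<Longrightarrow> top_digit x y = top_digit z w"
  unfolding same_def using E_top_digit top_digit_commute by metis

lemma same_dig:
  "same x y z w \<Longrightarrow> dig x (top_digit x y) = dig z (top_digit x y) \<and> dig y (top_digit x y) = dig w (top_digit x y) \<or>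
    dig x (top_digit x y) = dig w (top_digit x y) \<and> dig y (top_digit x y) = dig z (top_digit x y)"
  unfolding same_def using E_dig by metis

text \<open>At the top position of \<open>x\<close> and \<open>y\<close>, the vertices
  \<open>z\<close> and \<open>w\<close> carry the same two digits. So exactly one of them agrees
  with \<open>x\<close> there, and the signs in \<open>E\<close> reveal agreement.\<close>

lemma same_no_cherry:
  assumes V: "x < M ^ m" "y < M ^ m" and ne: "x \<noteq> y" and s: "same x y z w"
  shows "\<not> same x z x w"
proof
  assume c: "same x z x w"
  let ?j = "top_digit x y"
  have j: "?j < m" "dig x ?j \<noteq> dig y ?j"
    using top_digit_less dig_top_digit_neq V ne by auto
  have "dig x ?j = dig z ?j \<longleftrightarrow> dig x ?j = dig w ?j"
    using c E_dig_eq_iff[OF _ j(1)] unfolding same_def by metis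
  with same_dig[OF s] j(2) show False by metis
qed

lemma E_star:
  assumes V: "x < M ^ m" "z < M ^ m" and ne: "x \<noteq> z" and c: "same x z x w"
  shows "E x z = E x w"
proof (rule ccontr)
  assume "E x z \<noteq> E x w"
  then have "E x z = E w x" using c by (simp add: same_def)
  from E_dig(2)[OF this] dig_top_digit_neq[OF V ne] show False by simp
qed

text \<open>At the highest position \<open>t\<close> where \<open>S\<close> is not constant,
  \<open>A\<close> collects the vertices with one particular digit. A cross edge has top position
  \<open>t\<close> and involves this digit; an edge inside a part has a lower top position or avoids
  the digit.\<close>

lemma split_digits:
  assumes S: "S \<subseteq> {..<M ^ m}" "card S \<ge> 2"
  obtains A B where "A \<noteq> {}" "B \<noteq> {}" "A \<inter> B = {}" "A \<union> B = S"
    "\<And>a b x y. a \<in> A \<Longrightarrow> b \<in> B \<Longrightarrow> x \<in> A \<and> y \<in> A \<or> x \<in> B \<and> y \<in> B \<Longrightarrow> x \<noteq> y \<Longrightarrow> \<not> same a b x y"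
    "\<And>a a' b b'. a \<in> A \<Longrightarrow> a' \<in> A \<Longrightarrow> b \<in> B \<Longrightarrow> b' \<in> B \<Longrightarrow> a \<noteq> a' \<Longrightarrow> b \<noteq> b' \<Longrightarrow> same a a' b b' \<Longrightarrow>
      same a b a' b' \<Longrightarrow> \<not> same a b' a' b"
proof -
  define P where "P k \<longleftrightarrow> (\<forall>x\<in>S. \<forall>y\<in>S. x div M ^ Suc k = y div M ^ Suc k)" for k
  define t where "t = (LEAST k. P k)"
  have "P (m - 1)"
    unfolding P_def
  proof (intro ballI)
    fix x y assume "x \<in> S" "y \<in> S"
    then have "x < M ^ m" "y < M ^ m" using S by auto
    then show "x div M ^ Suc (m - 1) = y div M ^ Suc (m - 1)" using m by simp
  qed
  then have Pt: "P t" and "t \<le> m - 1"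
    unfolding t_def by (auto intro: LeastI Least_le)
  have "\<exists>a\<in>S. \<exists>b\<in>S. a div M ^ t \<noteq> b div M ^ t"
  proof (cases t)
    case 0
    obtain a b where "a \<in> S" "b \<in> S" "a \<noteq> b"
      using S(2) by (metis card_le_Suc0_iff_eq card.infinite not_less_eq_eq numeral_2_eq_2 zero_le)
    then show ?thesis using 0 by auto
  next
    case (Suc k)
    then have "\<not> P k" using not_less_Least[of k P] by (simp add: t_def)
    then show ?thesis unfolding P_def Suc by blast
  qed
  then obtain a0 b0 where a0: "a0 \<in> S" "b0 \<in> S" "a0 div M ^ t \<noteq> b0 div M ^ t" by blast
  define A where "A = {x \<in> S. x div M ^ t = a0 div M ^ t}"
  define B where "B = {x \<in> S. x div M ^ t \<noteq> a0 div M ^ t}"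
  have S': "x < M ^ m" if "x \<in> A \<or> x \<in> B" for x
    using that S by (auto simp: A_def B_def)
  have top_AB: "top_digit a b = t" if "a \<in> A" "b \<in> B" for a b
    using Pt that by (intro top_digit_eqI) (auto simp: P_def A_def B_def simp del: power_Suc)
  have dig_A: "dig a t = dig a' t" if "a \<in> A" "a' \<in> A" for a a'
    using that by (intro dig_eq_if[of _ t]) (auto simp: A_def)
  have AB_ne: "a \<noteq> b" if "a \<in> A" "b \<in> B" for a b
    using that by (auto simp: A_def B_def)
  have dig_AB: "dig a t \<noteq> dig b t" if "a \<in> A" "b \<in> B" for a b
    using dig_top_digit_neq[of a b] AB_ne[OF that] S' that top_AB[OF that] by auto
  have cross: "\<not> same a b x y"
    if ab: "a \<in> A" "b \<in> B" and xy: "x \<in> A \<and> y \<in> A \<or> x \<in> B \<and> y \<in> B" and ne: "x \<noteq> y" for a b x y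
  proof
    assume s: "same a b x y"
    have t: "top_digit x y = t" using same_top_digit[OF s] top_AB ab by simp
    have "dig x t \<noteq> dig y t"
      using dig_top_digit_neq[of x y] S' xy ne t by auto
    moreover have "dig a t = dig x t \<or> dig a t = dig y t"
      using same_dig[OF s] top_AB[OF ab] by auto
    ultimately show False
      using xy dig_A dig_AB ab by metis
  qed
  have striped: "\<not> same a b' a' b"
    if ab: "a \<in> A" "a' \<in> A" "b \<in> B" "b' \<in> B" and ne: "a \<noteq> a'" "b \<noteq> b'" and s: "same a a' b b'" "same a b a' b'"
    for a a' b b'
  proof
    assume s': "same a b' a' b"
    let ?j = "top_digit a a'"
    have j: "?j < m" "dig a ?j \<noteq> dig a' ?j"
      using top_digit_less dig_top_digit_neq S' ab ne by auto
    \<comment> \<open>The digit of \<open>A\<close> at \<open>t\<close> fixes the direction in which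
      cross edges match. At \<open>?j\<close> the vertices \<open>b\<close>, \<open>b'\<close> carry
      the two digits of \<open>a\<close>, \<open>a'\<close>, so one of \<open>e1\<close>,
      \<open>e2\<close> equates a nonzero sign with its negative.\<close>
    have "E a b = E a' b'"
      using s(2) E_dig(1)[of a b b' a'] top_AB[OF ab(1,3)] dig_AB[OF ab(1,4)] by (auto simp: same_def)
    note e1 = E_sgn[OF this j(1)]
    have "E a b' = E a' b"
      using s' E_dig(1)[of a b' b a'] top_AB[OF ab(1,4)] dig_AB[OF ab(1,3)] by (auto simp: same_def)
    note e2 = E_sgn[OF this j(1)]
    show False
      using same_dig[OF s(1)] e1 e2 j(2) by (auto simp: sgn_if split: if_splits)
  qed
  show thesis
    by (rule that[of A B]) (use a0 cross striped in \<open>auto simp: A_def B_def\<close>)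
qed

lemma E_range: "x < M ^ m \<Longrightarrow> y < M ^ m \<Longrightarrow>
    E x y \<in> {..<m} \<times> {..<M} \<times> {..<M} \<times> {l. set l \<subseteq> {-1, 0, 1} \<and> length l = m}"
  using top_digit_less M by (auto simp: E_def dig_def sgn_if)

lemma card_E_range:
  "card ({..<m} \<times> {..<M} \<times> {..<M} \<times> {l :: int list. set l \<subseteq> {-1, 0, 1} \<and> length l = m}) = m * (M * (M * 3 ^ m))"
  using card_lists_length_eq[of "{-1, 0, 1 :: int}" m]
  by (simp add: card_cartesian_product numeral_3_eq_3)

end

subsection \<open>The product colouring\<close>


lemma Collect_eq_image2: "{g x y | x y. P x y} = (\<lambda>(x, y). g x y) ` {(x, y). P x y}"
  by auto

locale combined_coloring = digits M m + space_coloring X1 X2 X3 T "{..<n}"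
  for M m :: nat and X1 X2 X3 :: "nat \<Rightarrow> 'a::field" and T :: "'a \<Rightarrow> bool" and n :: nat +
  assumes n_le: "n \<le> M ^ m"
begin

definition "C x y = (E x y, D x y)"

definition "edge_color x y = C (min x y) (max x y)"

lemma C_swap: "C x y = C x' y' \<Longrightarrow> C y x = C y' x'"
  unfolding C_def using E_swap D_swap by blast

lemma edge_color_eqD:
  assumes "edge_color x y = edge_color z w"
  shows "C x y = C z w \<or> C x y = C w z"
proof -
  have "edge_color x y = C x y \<or> edge_color x y = C y x" for x y
    by (simp add: edge_color_def min_def max_def)
  then have "C x y = C z w \<or> C x y = C w z \<or> C y x = C z w \<or> C y x = C w z"
    using assms by metis
  then show ?thesis
    using C_swap by blast
qed

lemma edge_color_same: "edge_color x y = edge_color z w \<Longrightarrow> same x y z w"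
  using edge_color_eqD[of x y z w] by (auto simp: C_def same_def)

text \<open>At a common centre the digit factor only allows both edges to be read outwards. This
  turns equal edge colours into equal values of \<open>D\<close>, which depends on the
  direction.\<close>

lemma edge_color_star:
  assumes "v < n" "w < n" "v \<noteq> w" "edge_color v w = edge_color v u"
  shows "D v w = D v u"
proof -
  have "v < M ^ m" "w < M ^ m" using assms n_le by auto
  from E_star[OF this assms(3) edge_color_same[OF assms(4)]] have E: "E v w = E v u" .
  have "E v w \<noteq> E u v"
    using E_dig(2)[of v w u v] dig_top_digit_neq[OF \<open>v < M ^ m\<close> \<open>w < M ^ m\<close> assms(3)] by auto
  then show ?thesis
    using edge_color_eqD[OF assms(4)] by (auto simp: C_def)
qed

sublocale splitting_coloring edge_color "{..<n}"
proof
  show "edge_color x y = edge_color y x" for x y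
    by (simp add: edge_color_def min.commute max.commute)
next
  fix x y z w assume "x \<in> {..<n}" "y \<in> {..<n}" "x \<noteq> y" "edge_color x y = edge_color z w"
  then show "edge_color x z \<noteq> edge_color x w"
    using same_no_cherry[of x y z w] edge_color_same n_le by (metis lessThan_iff order_less_le_trans)
next
  fix S :: "nat set" assume "S \<subseteq> {..<n}" "finite S" "card S \<ge> 2"
  then have "S \<subseteq> {..<M ^ m}" "card S \<ge> 2" using n_le by auto
  then obtain A B where AB: "A \<noteq> {}" "B \<noteq> {}" "A \<inter> B = {}" "A \<union> B = S"
    and cross: "\<And>a b x y. a \<in> A \<Longrightarrow> b \<in> B \<Longrightarrow> x \<in> A \<and> y \<in> A \<or> x \<in> B \<and> y \<in> B \<Longrightarrow> x \<noteq> y \<Longrightarrow> \<not> same a b x y"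
    and striped: "\<And>a a' b b'. a \<in> A \<Longrightarrow> a' \<in> A \<Longrightarrow> b \<in> B \<Longrightarrow> b' \<in> B \<Longrightarrow> a \<noteq> a' \<Longrightarrow> b \<noteq> b' \<Longrightarrow> same a a' b b' \<Longrightarrow>
      same a b a' b' \<Longrightarrow> \<not> same a b' a' b"
    by (rule split_digits) (rule that; assumption)
  have "cross edge_color A B \<inter> (colors edge_color A \<union> colors edge_color B) = {}"
    using cross edge_color_same unfolding cross_def colors_def by blast
  moreover have "\<forall>a\<in>A. \<forall>a'\<in>A. \<forall>b\<in>B. \<forall>b'\<in>B. a \<noteq> a' \<longrightarrow> b \<noteq> b' \<longrightarrow> edge_color a a' = edge_color b b' \<longrightarrow>
      edge_color a b = edge_color a' b' \<longrightarrow> edge_color a b' \<noteq> edge_color a' b"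
    using striped edge_color_same by blast
  ultimately show "\<exists>A B. A \<noteq> {} \<and> B \<noteq> {} \<and> A \<inter> B = {} \<and> A \<union> B = S \<and>
      cross edge_color A B \<inter> (colors edge_color A \<union> colors edge_color B) = {} \<and>
      (\<forall>a\<in>A. \<forall>a'\<in>A. \<forall>b\<in>B. \<forall>b'\<in>B. a \<noteq> a' \<longrightarrow> b \<noteq> b' \<longrightarrow> edge_color a a' = edge_color b b' \<longrightarrow>
        edge_color a b = edge_color a' b' \<longrightarrow> edge_color a b' \<noteq> edge_color a' b)"
    using AB by blast
qed

text \<open>Consecutive edges of the 4-cycle share a vertex, so \<open>edge_color_star\<close>
  carries the direction around the grid.\<close>

lemma edge_color_grid:
  assumes "a < n" "a' < n" "b < n" "b' < n" "a \<noteq> b" "a' \<noteq> b" "a' \<noteq> b'"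
    and "edge_color a b = edge_color a b'" "edge_color a b = edge_color a' b" "edge_color a b = edge_color a' b'"
  shows "D a b = D a b'" "D a b = D a' b" "D a b = D a' b'"
proof -
  show 1: "D a b = D a b'"
    using edge_color_star[of a b b'] assms by simp
  have "D b a = D b a'"
    using edge_color_star[of b a a'] assms by (metis sym)
  then show 2: "D a b = D a' b" by (rule D_swap)
  have "D a' b = D a' b'"
    using edge_color_star[of a' b b'] assms by simp
  with 2 show "D a b = D a' b'" by simp
qed

lemma five_colors:
  assumes S: "S \<subseteq> {..<n}" "card S = 5"
  shows "card (colors edge_color S) \<ge> 5"
proof (rule ccontr)
  assume "\<not> ?thesis"
  then have le: "card (colors edge_color S) \<le> 4" by simp
  have dist: "distinct xs" if "S = set xs" "length xs = 5" for xs
    using that S(2) by (metis card_distinct)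
  show False
  proof (cases rule: card_5_colors[OF S le, case_names nested_stars star_over_grid grid_over_cherry])
    case (nested_stars v w u x y)
    then have d: "distinct [v, w, u, x, y]" by (intro dist) auto
    then have ne: "v \<noteq> w" "w \<noteq> u" "u \<noteq> x" by auto
    have n: "v < n" "w < n" "u < n" "x < n" "y < n" using S nested_stars(1) by auto
    note v = edge_color_star[OF n(1,2) ne(1)]
    note w = edge_color_star[OF n(2,3) ne(2)]
    note u = edge_color_star[OF n(3,4) ne(3)]
    show False
      by (rule no_nested_stars[OF _ _ _ _ _ d v[OF nested_stars(2)] v[OF nested_stars(3)]
          v[OF nested_stars(4)] w[OF nested_stars(5)] w[OF nested_stars(6)] u[OF nested_stars(7)]])
        (use n in simp_all)
  next
    case (star_over_grid v a a' b b')
    then have d: "distinct [v, a, a', b, b']" by (intro dist) auto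
    then have ne: "v \<noteq> a" "a \<noteq> b" "a' \<noteq> b" "a' \<noteq> b'" by auto
    have n: "v < n" "a < n" "a' < n" "b < n" "b' < n" using S star_over_grid(1) by auto
    note v = edge_color_star[OF n(1,2) ne(1)]
    show False
      by (rule no_star_over_grid[OF _ _ _ _ _ d v[OF star_over_grid(2)] v[OF star_over_grid(3)]
          v[OF star_over_grid(4)] edge_color_grid[OF n(2-5) ne(2-4) star_over_grid(5-7)]])
        (use n in simp_all)
  next
    case (grid_over_cherry a a' x y z)
    then have d: "distinct [a, a', x, y, z]" by (intro dist) auto
    then have ne: "a \<noteq> x" "a' \<noteq> x" "a' \<noteq> y" "a' \<noteq> z" "x \<noteq> y" by auto
    have n: "a < n" "a' < n" "x < n" "y < n" "z < n" using S grid_over_cherry(1) by auto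
    note y = edge_color_grid[OF n(1-4) ne(1-3) grid_over_cherry(2,4,5)]
    note z = edge_color_grid[OF n(1-3,5) ne(1,2,4) grid_over_cherry(3,4,6)]
    show False
      by (rule no_grid_over_cherry[OF _ _ _ _ _ d y(1) z(1) y(2,3) z(3)
          edge_color_star[OF n(3,4) ne(5) grid_over_cherry(7)]])
        (use n in simp_all)
  qed
qed

text \<open>The factor 32 counts the five bits in \<open>D\<close>.\<close>

lemma gen_ramsey_le:
  assumes val: "\<And>v w. v < n \<Longrightarrow> w < n \<Longrightarrow> val v w \<in> F" and F: "finite F"
  shows "gen_ramsey n 5 5 \<le> m * (M * (M * 3 ^ m)) * (32 * card F)"
proof -
  define R where "R = ({..<m} \<times> {..<M} \<times> {..<M} \<times> {l :: int list. set l \<subseteq> {-1, 0, 1} \<and> length l = m}) \<times>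
    ((UNIV :: bool set) \<times> (UNIV :: bool set) \<times> (UNIV :: bool set) \<times> (UNIV :: bool set) \<times> (UNIV :: bool set) \<times> F)"
  have "card R = m * (M * (M * 3 ^ m)) * (32 * card F)"
    unfolding R_def card_cartesian_product[of "_ \<times> _ \<times> _ \<times> _" "_ \<times> _"] card_E_range
    by (simp add: card_cartesian_product)
  have finR: "finite R"
    using F by (auto simp: R_def finite_lists_length_eq)
  have range: "edge_color x y \<in> R" if "x < n" "y < n" for x y
  proof -
    have "C x y \<in> R" if "x < n" "y < n" for x y
      using that E_range[of x y] n_le val unfolding C_def D_def R_def by (intro SigmaI) auto
    then show ?thesis using that by (simp add: edge_color_def min_def max_def)
  qed
  obtain enc :: "_ \<Rightarrow> nat" where enc: "inj_on enc R"
    using finite_imp_inj_to_nat_seg[OF finR] by blast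
  define c where "c e = enc (edge_color (Min e) (Max e))" for e
  have c: "c ` [S]\<^bsup>2\<^esup> = enc ` colors edge_color S" for S
  proof -
    have "[S]\<^bsup>2\<^esup> = {{x, y} | x y. x \<in> S \<and> y \<in> S \<and> x \<noteq> y}"
      unfolding nsets_def by (auto simp: card_2_iff)
    then show ?thesis
      unfolding colors_def Collect_eq_image2 by (simp add: image_image c_def edge_color_def case_prod_beta)
  qed
  have sub: "colors edge_color S \<subseteq> R" if "S \<subseteq> {..<n}" for S
    using range that unfolding colors_def by blast
  have card: "card (c ` [S]\<^bsup>2\<^esup>) = card (colors edge_color S)" if "S \<subseteq> {..<n}" for S
    unfolding c by (intro card_image inj_on_subset[OF enc] sub that)
  have "pq_coloring n 5 5 c"
    unfolding pq_coloring_def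
  proof
    fix S assume "S \<in> [{..<n}]\<^bsup>5\<^esup>"
    then have S: "S \<subseteq> {..<n}" "card S = 5" by (auto simp: nsets_def)
    show "5 \<le> card (c ` [S]\<^bsup>2\<^esup>)"
      unfolding card[OF S(1)] by (rule five_colors[OF S])
  qed
  then have "gen_ramsey n 5 5 \<le> num_colors n c"
    unfolding gen_ramsey_def by (intro Least_le) blast
  also have "\<dots> = card (colors edge_color {..<n})"
    unfolding num_colors_def by (rule card) simp
  also have "\<dots> \<le> card R"
    by (intro card_mono finR sub) simp
  finally show ?thesis using \<open>card R = _\<close> by simp
qed

end

section \<open>Realisation over the field of order \<open>3 ^ k\<close> and choice of
  parameters\<close>

lemma gen_ramsey_5_5_le:
  assumes "M > 1" "m > 0" "n \<le> M ^ m" and k: "odd k" "n \<le> (3 ^ k) ^ 3"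
  shows "gen_ramsey n 5 5 \<le> m * (M * (M * 3 ^ m)) * (32 * 3 ^ k)"
proof -
  define F :: "Enum.finite_3 alg_closure set" where "F = frob_fixed k"
  note three = three_eq_0_finite_3_closure
  have card: "card F = 3 ^ k"
    unfolding F_def by (rule card_frob_fixed[OF three]) (use k in \<open>auto intro: Nat.gr0I\<close>)
  then have fin: "finite F" by (metis card.infinite power_not_zero zero_neq_numeral)
  have "card (F \<times> F \<times> F) = (3 ^ k) ^ 3"
    by (simp add: card card_cartesian_product power3_eq_cube)
  then have "card {..<n} \<le> card (F \<times> F \<times> F)" using k by simp
  then obtain p where p: "p ` {..<n} \<subseteq> F \<times> F \<times> F" "inj_on p {..<n}"
    using card_le_inj[of "{..<n}" "F \<times> F \<times> F"] fin by auto
  define X1 X2 X3 where "X1 v = fst (p v)" and "X2 v = fst (snd (p v))" and "X3 v = snd (snd (p v))" for v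
  have X123: "X1 v \<in> F" "X2 v \<in> F" "X3 v \<in> F" if "v < n" for v
    using p(1) that by (force simp: X1_def X2_def X3_def)+
  note closed = frob_fixed_add[OF three] frob_fixed_diff[OF three] frob_fixed_mult frob_fixed_divide
  obtain idx :: "_ \<Rightarrow> nat" where idx: "inj_on idx F"
    using finite_imp_inj_to_nat_seg[OF fin] by blast
  \<comment> \<open>On nonzero elements of \<open>F\<close>, \<open>s\<close> and
    \<open>-1/s\<close> form orbits of size 2; \<open>T\<close> marks the element of smaller
    index.\<close>
  define T where "T s \<longleftrightarrow> idx s < idx (- 1 / s)" for s
  have T: "T s \<noteq> T (- 1 / s)" if "s \<in> F" "s \<noteq> 0" for s
  proof -
    have "- 1 / s \<in> F"
      using that(1) frob_fixed_uminus[OF frob_fixed_divide[of 1 k s]] by (simp add: F_def frob_fixed_def)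
    moreover have "s \<noteq> - 1 / s"
    proof
      assume "s = - 1 / s"
      then have "s ^ 2 = - 1" using that(2) by (simp add: power2_eq_square field_simps)
      then show False
        using minus_one_nonsquare_frob_fixed[OF three k(1)] that(1) by (simp add: F_def)
    qed
    ultimately have "idx s \<noteq> idx (- 1 / s)"
      using idx that(1) by (auto dest: inj_onD)
    then show ?thesis using that(2) by (auto simp: T_def)
  qed
  interpret combined_coloring M m X1 X2 X3 T n
  proof
    fix v w assume "v \<in> {..<n}" "w \<in> {..<n}" "X1 v = X1 w" "X2 v = X2 w" "X3 v = X3 w"
    moreover from this have "p v = p w"
      by (simp add: X1_def X2_def X3_def prod_eq_iff)
    ultimately show "v = w"
      using p(2) by (auto dest: inj_onD)
  next
    fix v a b assume V: "v \<in> {..<n}" "a \<in> {..<n}" "b \<in> {..<n}" and ne: "X1 a \<noteq> X1 v" "X2 a \<noteq> X2 v" "X1 b \<noteq> X1 v"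
      and orth: "(X1 a - X1 v) * (X1 b - X1 v) + (X2 a - X2 v) * (X2 b - X2 v) = 0"
    define s where "s = (X2 a - X2 v) / (X1 a - X1 v)"
    have s: "s \<in> F" "s \<noteq> 0"
      using V ne by (auto simp: s_def F_def intro!: closed X123[unfolded F_def])
    have quot: "(X2 b - X2 v) / (X1 b - X1 v) = - 1 / s"
      using ne orth by (simp add: s_def field_simps)
    show "T ((X2 a - X2 v) / (X1 a - X1 v)) \<noteq> T ((X2 b - X2 v) / (X1 b - X1 v))"
      unfolding quot s_def[symmetric] by (rule T[OF s])
  qed (use assms in auto)
  have "val v w \<in> F" if "v < n" "w < n" for v w
    using that by (auto simp: val_def B_def F_def intro!: closed X123[unfolded F_def])
  from gen_ramsey_le[OF this fin] show ?thesis by (simp add: card)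
qed

text \<open>For \<open>27 ^ j <= n < 27 ^ (j + 1)\<close>, one of \<open>j + 1\<close> and
  \<open>j + 2\<close> is odd; the larger one costs the factor 9.\<close>

lemma power_27_bounds:
  assumes "n \<ge> (1::nat)"
  obtains k where "odd k" "n \<le> (3 ^ k) ^ 3" "real (3 ^ k) \<le> 9 * real n powr (1/3)"
proof -
  obtain j where j: "27 ^ j \<le> n" "n < 27 ^ Suc j"
    using ex_power_ivl1[of 27 n] assms by auto
  have "(27::real) ^ j = (3 ^ 3) ^ j" by simp
  also have "\<dots> = (3 ^ j) powr 3"
    by (simp only: powr_numeral zero_le_power zero_le_numeral power_mult[symmetric] mult.commute)
  finally have "(27 ^ j) powr (1/3) = (3 ^ j :: real) powr (3 * (1/3))"
    by (simp only: powr_powr)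
  then have "3 ^ j = (27 ^ j) powr (1/3 :: real)" by simp
  also have "(27 ^ j) powr (1/3) \<le> real n powr (1/3)"
  proof (rule powr_mono2)
    have "real (27 ^ j) \<le> real n" using j(1) by (simp only: of_nat_le_iff)
    then show "27 ^ j \<le> real n" by simp
  qed simp_all
  finally have 1: "3 ^ j \<le> real n powr (1/3)" .
  define k where "k = (if even j then Suc j else Suc (Suc j))"
  have "n \<le> 27 ^ Suc j" using j by simp
  also have "\<dots> \<le> 27 ^ k" by (rule power_increasing) (auto simp: k_def)
  also have "\<dots> = (3 ^ k) ^ 3" by (simp flip: power_mult add: mult.commute[of k]) (simp add: power_mult)
  finally have 2: "n \<le> (3 ^ k) ^ 3" .
  have "real (3 ^ k) \<le> 9 * 3 ^ j"
    by (simp add: k_def)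
  also have "\<dots> \<le> 9 * real n powr (1/3)" using 1 by simp
  finally show thesis
    using 2 by (intro that[of k]) (auto simp: k_def)
qed

theorem theorem1:
  "\<exists>g \<in> O(\<lambda>n::nat. sqrt (ln (real n)) * ln (ln (real n))).
     \<forall>\<^sub>F n in sequentially. real (gen_ramsey n 5 5) \<le> real n powr (1/3) * 2 powr (g n :: real)"
proof (intro bexI)
  \<comment> \<open>No factor \<open>ln (ln n)\<close> arises. The constant is 14 = 9 + 5:
    \<open>288 = 32 * 9\<close> is below \<open>2 ^ 9\<close>, and rounding up in \<open>m\<close>
    adds at most 5 to \<open>5 * m\<close>.\<close>
  define g where "g n = 14 + 5 * sqrt (log 2 (real n))" for n :: nat
  show "g \<in> O(\<lambda>n::nat. sqrt (ln (real n)) * ln (ln (real n)))"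
    unfolding g_def log_def by real_asymp
  show "\<forall>\<^sub>F n in sequentially. real (gen_ramsey n 5 5) \<le> real n powr (1/3) * 2 powr g n"
    using eventually_ge_at_top[of 2]
  proof eventually_elim
    case (elim n)
    \<comment> \<open>The base is \<open>2 ^ m\<close>, and \<open>m\<close> is least with
      \<open>m ^ 2\<close> at least \<open>log 2 n\<close>, so that \<open>m\<close> digits suffice
      for \<open>n\<close> vertices.\<close>
    define m where "m = nat \<lceil>sqrt (log 2 (real n))\<rceil>"
    have log: "log 2 (real n) \<ge> 1" using elim by simp
    then have m: "m > 0" "sqrt (log 2 (real n)) \<le> m" "m \<le> sqrt (log 2 (real n)) + 1"
      by (auto simp: m_def)
    obtain k where k: "odd k" "n \<le> (3 ^ k) ^ 3" "real (3 ^ k) \<le> 9 * real n powr (1/3)"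
      using power_27_bounds[of n] elim by auto
    have "log 2 (real n) = sqrt (log 2 (real n)) ^ 2"
      using log by simp
    also have "\<dots> \<le> real m ^ 2"
      using m(2) log by (intro power_mono) auto
    finally have "real n \<le> 2 powr (real m ^ 2)"
      using elim by (simp add: log_le_iff)
    also have "\<dots> = real ((2 ^ m) ^ m)"
      by (simp add: power2_eq_square powr_realpow flip: power_mult of_nat_mult)
    finally have "n \<le> (2 ^ m) ^ m"
      by (simp only: of_nat_le_iff)
    moreover have "(2::nat) ^ m > 1" using one_less_power[of "2::nat" m] m(1) by simp
    ultimately have "gen_ramsey n 5 5 \<le> m * (2 ^ m * (2 ^ m * 3 ^ m)) * (32 * 3 ^ k)"
      using gen_ramsey_5_5_le[of "2 ^ m" m n k] m(1) k by simp
    then have "real (gen_ramsey n 5 5) \<le> real (m * (2 ^ m * (2 ^ m * 3 ^ m)) * (32 * 3 ^ k))"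
      by (simp only: of_nat_le_iff)
    also have "\<dots> = real m * 2 ^ m * 2 ^ m * 3 ^ m * 32 * real (3 ^ k)"
      by simp
    \<comment> \<open>This amounts to five factors \<open>2 ^ m\<close>: two for the digits at the
      top position, one bounding \<open>m\<close>, and two from
      \<open>3 ^ m \<le> 4 ^ m\<close>.\<close>
    also have "\<dots> \<le> 2 ^ m * 2 ^ m * 2 ^ m * 4 ^ m * 32 * (9 * real n powr (1/3))"
    proof -
      have "real m \<le> 2 ^ m" using of_nat_less_two_power[of m, where 'a = real] by simp
      moreover have "(3::real) ^ m \<le> 4 ^ m" by (intro power_mono) auto
      ultimately show ?thesis using k(3) by (intro mult_mono) auto
    qed
    also have "\<dots> = real n powr (1/3) * (288 * 2 ^ (5 * m))"
    proof -
      have "(2::real) ^ (5 * m) = 2 ^ m * 2 ^ m * 2 ^ m * (2 ^ 2) ^ m"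
      proof -
        have "5 * m = m + m + m + 2 * m" by simp
        then show ?thesis by (simp only: power_add power_mult)
      qed
      then show ?thesis by simp
    qed
    also have "\<dots> \<le> real n powr (1/3) * 2 powr g n"
    proof (rule mult_left_mono)
      have "(288::real) * 2 ^ (5 * m) \<le> 2 ^ 9 * 2 ^ (5 * m)" by simp
      also have "\<dots> = 2 powr (9 + 5 * real m)"
        by (simp add: powr_add powr_realpow flip: of_nat_mult)
          (metis of_nat_mult of_nat_numeral powr_realpow zero_less_numeral)
      also have "\<dots> \<le> 2 powr g n"
        using m(3) by (intro powr_mono) (auto simp: g_def)
      finally show "288 * 2 ^ (5 * m) \<le> 2 powr g n" .
    qed simp
    finally show ?case .
  qed
qed

end
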